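(* Let $n\ge 3$, let $\{a_{ij}\}_{i,j=1}^n$ be an array of real numbers with $\sum_{j=1}^n a_{ij}=0$ for all $i$, let $C=\max_{i,j}|a_{ij}|$, and let $\pi$ be a random permutation with the uniform distribution over the symmetric group $\mathcal{S}_n$. Let $Y=\sum_{i=1}^n a_{i,\pi(i)}$, suppose $\sigma^2=\mathrm{Var}(Y)>0$, and let $W=Y/\sigma$. Set $A=8C/\sigma$ and suppose $A\le 1/12$. Let $\mathcal{H}$ be a class of functions satisfying (i), (ii), (iii) of the context with constant $a$, and let $\delta=\sup_{h\in\mathcal{H}}|E h(W)-Nh|$. Then $$\delta\le A\,(37+12A+112a).$$ Moreover, when $\mathcal{H}$ is the collection of indicators of all half lines (using $a=\sqrt{2/\pi}$, where here $\pi$ denotes the circle constant), and when $\mathcal{H}$ is the collection of indicators of all intervals (using $a=2\sqrt{2/\pi}$), we have respectively $$\delta\le A(127+12A)\qquad\text{and}\qquad \delta\le A(216+12A).$$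
   Context: $Nh=E h(Z)$ where $Z\sim\mathcal{N}(0,1)$. $\mathcal{H}$ is a class of measurable functions on the real line such that: (i) the functions $h\in\mathcal{H}$ are uniformly bounded in absolute value by $1$; (ii) for any real numbers $c,d$ and any $h\in\mathcal{H}$, the function $x\mapsto h(cx+d)$ is in $\mathcal{H}$; (iii) for any $\epsilon>0$ and $h\in\mathcal{H}$, the functions $h^+_\epsilon(x)=\sup_{|y|\le\epsilon}h(x+y)$ and $h^-_\epsilon(x)=\inf_{|y|\le\epsilon}h(x+y)$ are also in $\mathcal{H}$, and, with $\tilde h_\epsilon=h^+_\epsilon-h^-_\epsilon$, $E\tilde h_\epsilon(Z)\le a\epsilon$ for some constant $a$ depending only on the class $\mathcal{H}$. *)

theory Defs
  imports "HOL-Probability.Probability" "HOL-Combinatorics.Permutations"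
begin

definition upper_env :: "real \<Rightarrow> (real \<Rightarrow> real) \<Rightarrow> real \<Rightarrow> real" where
  "upper_env \<epsilon> h x = (SUP y\<in>{y. \<bar>y\<bar> \<le> \<epsilon>}. h (x + y))"

definition lower_env :: "real \<Rightarrow> (real \<Rightarrow> real) \<Rightarrow> real \<Rightarrow> real" where
  "lower_env \<epsilon> h x = (INF y\<in>{y. \<bar>y\<bar> \<le> \<epsilon>}. h (x + y))"

definition normal_mean :: "(real \<Rightarrow> real) \<Rightarrow> real" where
  "normal_mean h = (\<integral>x. h x \<partial>std_normal_distribution)"

definition smoothing_constant :: "(real \<Rightarrow> real) set \<Rightarrow> real \<Rightarrow> bool" where
  "smoothing_constant H a \<longleftrightarrow>
     (\<forall>\<epsilon>>0. \<forall>h\<in>H. normal_mean (\<lambda>x. upper_env \<epsilon> h x - lower_env \<epsilon> h x) \<le> a * \<epsilon>)"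

text \<open>Nonemptiness is implicit in taking a supremum over the class; it is needed because the
  supremum of the empty set of reals is unspecified.\<close>

definition smoothing_class :: "(real \<Rightarrow> real) set \<Rightarrow> real \<Rightarrow> bool" where
  "smoothing_class H a \<longleftrightarrow>
     H \<noteq> {} \<and>
     H \<subseteq> borel_measurable borel \<and>
     (\<forall>h\<in>H. \<forall>x. \<bar>h x\<bar> \<le> 1) \<and>
     (\<forall>h\<in>H. \<forall>c d. (\<lambda>x. h (c * x + d)) \<in> H) \<and>
     (\<forall>\<epsilon>>0. \<forall>h\<in>H. upper_env \<epsilon> h \<in> H \<and> lower_env \<epsilon> h \<in> H) \<and>
     smoothing_constant H a"

text \<open>Half lines may be open or closed and point in either direction.\<close>

definition half_line_indicators :: "(real \<Rightarrow> real) set" where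
  "half_line_indicators =
     {indicator S | S. \<exists>z. S = {..z} \<or> S = {..<z} \<or> S = {z..} \<or> S = {z<..}}"

definition interval_indicators :: "(real \<Rightarrow> real) set" where
  "interval_indicators = {indicator S | S. is_interval S}"

definition uniform_random_permutation ::
  "'w measure \<Rightarrow> nat \<Rightarrow> ('w \<Rightarrow> nat \<Rightarrow> nat) \<Rightarrow> bool" where
  "uniform_random_permutation M n \<pi> \<longleftrightarrow>
     \<pi> \<in> measurable M (count_space {p. p permutes {1..n}}) \<and>
     distr M (count_space {p. p permutes {1..n}}) \<pi> =
       uniform_count_measure {p. p permutes {1..n}}"

definition normal_discrepancy ::
  "'w measure \<Rightarrow> ('w \<Rightarrow> real) \<Rightarrow> (real \<Rightarrow> real) set \<Rightarrow> real" where
  "normal_discrepancy M W H = (SUP h\<in>H. \<bar>(\<integral>\<omega>. h (W \<omega>) \<partial>M) - normal_mean h\<bar>)"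

end

theory Submission
  imports Defs
begin

text \<open>
  The proof is Stein's method with a zero-bias type coupling, followed by a smoothing argument
  that bootstraps the discrepancy against itself.

  After dividing the array by \<open>\<sigma>\<close> the statistic \<open>W\<close> has variance \<open>1\<close>. Exchanging the values that a
  uniform permutation takes at two uniformly chosen indices gives an exchangeable pair for which
  linear regression holds exactly, because the rows of the array sum to zero
  (\<open>exchange_identity\<close>). The increment of \<open>W\<close> depends only on the two indices \<open>i, j\<close> and their two
  values \<open>k, l\<close>, so by the mean value theorem \<open>E W f(W)\<close> is a mixture, over quadruples
  \<open>(i, j, k, l)\<close> weighted by squared increments, of averages of \<open>f'\<close> over the permutations with
  \<open>p i = k\<close> and \<open>p j = l\<close>. A uniform permutation is turned into a uniform one of that kind by
  changing it at no more than four indices (\<open>sum_redirect_twice\<close>), which moves \<open>W\<close> by at most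
  \<open>A = 8 C / \<sigma>\<close>. Consequently, if \<open>\<bar>f' x - f' y\<bar> \<le> K x\<close> whenever \<open>\<bar>x - y\<bar> \<le> A\<close>, then
  \<open>\<bar>E f'(W) - E W f(W)\<bar> \<le> E K(W)\<close> (\<open>permutation_stein_bound\<close>). This is all that the rest of the
  argument uses about permutations.

  Given \<open>h\<close> in the class, let \<open>g\<close> be the average over windows \<open>[x - 2A, x + 2A]\<close> of the upper
  envelope of \<open>h\<close> at scale \<open>2A\<close>. Then \<open>h \<le> g\<close>, and \<open>Ng - Nh\<close> is at most the normal mean of the
  oscillation of \<open>h\<close> at scale \<open>4A\<close>, that is \<open>4 \<alpha> A\<close>. The solution of
  \<open>f'(x) - x f(x) = g(x) - Ng\<close> satisfies \<open>\<bar>f(x)\<bar> \<le> 10\<close> and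
  \<open>\<bar>x f(x)\<bar> \<le> 2\<close> (\<open>stein_solution\<close>), so \<open>\<bar>f'\<bar> \<le> 4\<close>. Hence
  \<open>x f(x)\<close> changes by at most \<open>A (4 \<bar>x\<bar> + 10)\<close> over a distance \<open>A\<close>, while \<open>g\<close> changes by at most a
  quarter of the oscillation of \<open>h\<close> at scale \<open>5A\<close> around \<open>x\<close> (\<open>window_average_modulus\<close>). The
  expectation of this oscillation at \<open>W\<close> is at most \<open>5 \<alpha> A + 2 \<delta>\<close>: it is a difference of two
  members of the class, each of which can be compared with its normal mean at the price \<open>\<delta>\<close>. With
  \<open>E \<bar>W\<bar> \<le> 1\<close> this yields \<open>E h(W) - Nh \<le> A (14 + 21/4 \<alpha>) + \<delta> / 2\<close>. The opposite inequality comes from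
  the lower envelope, and taking the supremum gives \<open>\<delta> \<le> A (28 + 21/2 \<alpha>)\<close>
  (\<open>discrepancy_bound\<close>), which is smaller than each of the three bounds claimed.
\<close>

section \<open>The Stein equation for the normal distribution\<close>

lemma integrable_bounded_normal:
  fixes h :: "real \<Rightarrow> real"
  assumes "h \<in> borel_measurable borel" "\<And>x. \<bar>h x\<bar> \<le> B"
  shows "integrable std_normal_distribution h"
proof -
  interpret prob_space std_normal_distribution by (rule prob_space_normal_density) simp
  show ?thesis by (rule integrable_const_bound[where B = B]) (use assms in auto)
qed

lemma normal_mean_lebesgue:
  assumes "h \<in> borel_measurable borel"
  shows "normal_mean h = (\<integral>x. std_normal_density x * h x \<partial>lborel)"
  unfolding normal_mean_def using assms by (subst integral_density) auto

lemma abs_normal_mean_le: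
  assumes "h \<in> borel_measurable borel" "\<And>x. \<bar>h x\<bar> \<le> B"
  shows "\<bar>normal_mean h\<bar> \<le> B"
proof -
  interpret prob_space std_normal_distribution by (rule prob_space_normal_density) simp
  have "\<bar>normal_mean h\<bar> \<le> (\<integral>x. \<bar>h x\<bar> \<partial>std_normal_distribution)"
    unfolding normal_mean_def by (rule integral_abs_bound)
  also have "\<dots> \<le> (\<integral>x. B \<partial>std_normal_distribution)"
    by (rule integral_mono) (use assms in \<open>auto intro!: integrable_abs integrable_bounded_normal\<close>)
  also have "\<dots> = B" using prob_space by simp
  finally show ?thesis .
qed

lemma integrable_std_normal_density: "integrable lborel std_normal_density"
  using integrable_std_normal_moment[of 0] by simp

definition upper_tail :: "real \<Rightarrow> real" where
  "upper_tail x = (\<integral>u. indicator {x..} u * std_normal_density u \<partial>lborel)"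

lemma integrable_tail: "S \<in> sets borel \<Longrightarrow> integrable lborel (\<lambda>u. indicator S u * std_normal_density u)"
  using integrable_mult_indicator[OF _ integrable_std_normal_density, of S] by simp

lemma has_derivative_std_normal_density:
  "(std_normal_density has_real_derivative - x * std_normal_density x) (at x)"
  unfolding std_normal_density_def[abs_def]
  by (auto intro!: derivative_eq_intros simp: field_simps)

lemma std_normal_density_at_top: "(std_normal_density \<longlongrightarrow> 0) at_top"
proof -
  have "((\<lambda>x::real. exp (- (x\<^sup>2 / 2))) \<longlongrightarrow> 0) at_top"
    using filterlim_tendsto_pos_mult_at_top[OF tendsto_const[of "1/2::real"] _
        filterlim_at_top_mult_at_top[OF filterlim_ident filterlim_ident]]
    by (intro filterlim_compose[OF exp_at_bot] filterlim_compose[OF filterlim_uminus_at_bot_at_top])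
       (simp add: power2_eq_square)
  from tendsto_mult_right[OF this, of "1 / sqrt (2 * pi)"]
  show ?thesis unfolding std_normal_density_def[abs_def] by simp
qed

text \<open>
  The classical Mills ratio estimate: on \<open>{x..}\<close> one may replace the factor \<open>x\<close> by the integration
  variable, and \<open>u * std_normal_density u\<close> has the antiderivative \<open>- std_normal_density u\<close>.
\<close>
lemma upper_tail_mult_le:
  assumes "0 \<le> x"
  shows "x * upper_tail x \<le> std_normal_density x"
proof -
  have int: "integrable lborel (\<lambda>u. indicator {x..} u * (u * std_normal_density u))"
    using integrable_mult_indicator[OF _ integrable_std_normal_moment[of 1], of "{x..}"]
    by (simp add: mult.commute)
  have "(\<integral>\<^sup>+u. ennreal (u * std_normal_density u) * indicator {x..} u \<partial>lborel)
      = ennreal (0 - - std_normal_density x)"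
  proof (rule nn_integral_FTC_atLeast)
    show "((\<lambda>u. - std_normal_density u) \<longlongrightarrow> 0) at_top"
      using tendsto_minus[OF std_normal_density_at_top] by simp
    show "((\<lambda>u. - std_normal_density u) has_real_derivative u * std_normal_density u) (at u)" for u
      using DERIV_minus[OF has_derivative_std_normal_density[of u]] by simp
  qed (use assms in auto)
  hence "(\<integral>\<^sup>+u. ennreal (indicator {x..} u * (u * std_normal_density u)) \<partial>lborel)
      = ennreal (std_normal_density x)"
    by (subst (asm) nn_integral_cong[where v = "\<lambda>u. ennreal (indicator {x..} u * (u * std_normal_density u))"])
       (auto simp: indicator_def)
  hence moment: "(\<integral>u. indicator {x..} u * (u * std_normal_density u) \<partial>lborel) = std_normal_density x"
    using assms by (subst integral_eq_nn_integral) (auto simp: indicator_def)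
  have "x * upper_tail x = (\<integral>u. x * (indicator {x..} u * std_normal_density u) \<partial>lborel)"
    unfolding upper_tail_def by simp
  also have "\<dots> \<le> (\<integral>u. indicator {x..} u * (u * std_normal_density u) \<partial>lborel)"
    by (intro integral_mono int integrable_mult_right integrable_tail)
       (auto simp: indicator_def intro!: mult_right_mono)
  finally show ?thesis using moment by simp
qed

lemma upper_tail_le_1: "upper_tail x \<le> 1"
proof -
  have "upper_tail x \<le> (\<integral>u. std_normal_density u \<partial>lborel)"
    unfolding upper_tail_def
    by (intro integral_mono integrable_tail integrable_std_normal_density) (auto simp: indicator_def)
  thus ?thesis using integral_std_normal_moment_even[of 0] by simp
qed

lemma upper_tail_nonneg: "0 \<le> upper_tail x"
  unfolding upper_tail_def by (intro integral_nonneg_AE) auto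

lemma lower_tail_eq: "(\<integral>u. indicator {..x} u * std_normal_density u \<partial>lborel) = upper_tail (- x)"
proof -
  have "(\<integral>u. indicator {..x} u * std_normal_density u \<partial>lborel)
     = (\<integral>u. indicator {..x} (-u) * std_normal_density (-u) \<partial>lborel)"
    by (subst lborel_integral_real_affine[where c = "-1" and t = 0]) auto
  also have "\<dots> = upper_tail (- x)"
    unfolding upper_tail_def
    by (intro Bochner_Integration.integral_cong) (auto simp: indicator_def std_normal_density_def)
  finally show ?thesis .
qed

text \<open>
  Beyond \<open>1\<close> the Mills ratio estimate applies; on \<open>[0, 1]\<close> the tail is at most \<open>1\<close> and the
  density is at least \<open>1 / sqrt (2 * pi * exp 1)\<close>, which exceeds \<open>1 / 5\<close>.
\<close>
lemma upper_tail_le_density: 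
  assumes "0 \<le> x" shows "2 * upper_tail x \<le> 10 * std_normal_density x"
proof (cases "x \<le> 1")
  case True
  have "(sqrt (2 * pi) * exp (1 / 2))\<^sup>2 = 2 * pi * exp (1::real)"
    by (simp add: power_mult_distrib exp_of_nat_mult[symmetric])
  also have "\<dots> \<le> 2 * 4 * (272 / 100)"
    using e_less_272 pi_less_4 by (intro mult_mono) auto
  also have "\<dots> \<le> 5\<^sup>2" by simp
  finally have c: "sqrt (2 * pi) * exp (1 / 2) \<le> 5" by (rule power2_le_imp_le) simp
  have "exp (- (1 / 2)) \<le> exp (- x\<^sup>2 / 2)" using True assms by (simp add: power_le_one)
  hence "1 \<le> exp (1 / 2) * exp (- x\<^sup>2 / 2)"
    by (simp add: exp_minus field_simps)
  also have "\<dots> = (sqrt (2 * pi) * exp (1 / 2)) * std_normal_density x"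
    by (simp add: std_normal_density_def)
  also have "\<dots> \<le> 5 * std_normal_density x" by (rule mult_right_mono[OF c]) simp
  finally show ?thesis using upper_tail_le_1[of x] by simp
next
  case False
  have "upper_tail x \<le> x * upper_tail x"
    using mult_right_mono[of 1 x "upper_tail x"] False upper_tail_nonneg[of x] by simp
  also have "\<dots> \<le> std_normal_density x" by (rule upper_tail_mult_le[OF assms])
  finally show ?thesis by (smt (verit) normal_density_nonneg)
qed

text \<open>
  The fundamental theorem of calculus with base point at minus infinity. It reduces to the compact
  case, since near \<open>x\<close> the integral is a constant plus an integral over \<open>[x - 1, y]\<close>.
\<close>
lemma DERIV_integral_atMost:
  fixes k :: "real \<Rightarrow> real"
  assumes "integrable lborel k" "continuous_on UNIV k"
  shows "((\<lambda>x. \<integral>u. indicator {..x} u * k u \<partial>lborel) has_real_derivative k x) (at x)"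
proof -
  define F where "F x = (\<integral>u. indicator {..x} u * k u \<partial>lborel)" for x
  have int: "integrable lborel (\<lambda>u. indicator S u * k u)" if "S \<in> sets borel" for S
    using integrable_mult_indicator[OF _ assms(1), of S] that by simp
  have F: "F y = F (x - 1) + integral {x - 1..y} k" if "x - 1 \<le> y" for y
  proof -
    have "F y - F (x - 1) = (\<integral>u. indicator {..y} u * k u - indicator {..x - 1} u * k u \<partial>lborel)"
      unfolding F_def by (intro Bochner_Integration.integral_diff[symmetric] int) auto
    also have "\<dots> = (\<integral>u. indicator {x - 1..y} u * k u \<partial>lborel)"
    proof (rule integral_cong_AE)
      show "AE u in lborel. indicator {..y} u * k u - indicator {..x - 1} u * k u = indicator {x - 1..y} u * k u"
        using AE_lborel_singleton[of "x - 1"] by eventually_elim (use that in \<open>auto simp: indicator_def\<close>)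
    qed (use assms(1) in \<open>auto intro!: borel_measurable_integrable int Bochner_Integration.integrable_diff\<close>)
    also have "\<dots> = integral {x - 1..y} k"
      using set_borel_integral_eq_integral(2)[of "{x - 1..y}" k] int[of "{x - 1..y}"]
      by (simp add: set_integrable_def set_lebesgue_integral_def)
    finally show ?thesis by simp
  qed
  have "((\<lambda>y. F (x - 1) + integral {x - 1..y} k) has_real_derivative k x) (at x within {x - 1..x + 1})"
    using integral_has_real_derivative[of "x - 1" "x + 1" k x] continuous_on_subset[OF assms(2)]
    by (auto intro!: derivative_eq_intros)
  hence "((\<lambda>y. F (x - 1) + integral {x - 1..y} k) has_real_derivative k x) (at x)"
    by (subst (asm) at_within_interior) auto
  hence "(F has_real_derivative k x) (at x)"
  proof (rule has_field_derivative_transform_within_open)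
    show "open {x - 1<..}" "x \<in> {x - 1<..}" by auto
    show "F (x - 1) + integral {x - 1..y} k = F y" if "y \<in> {x - 1<..}" for y
      using F[of y] that by simp
  qed
  thus ?thesis unfolding F_def .
qed

text \<open>
  The solution is \<open>f = F / \<phi>\<close>, where \<open>\<phi>\<close> is the normal density and \<open>F\<close> the antiderivative of
  \<open>\<phi> * (g - Ng)\<close> vanishing at minus infinity. The centring by \<open>Ng\<close> makes \<open>F\<close> vanish at
  infinity too, so \<open>\<bar>F x\<bar>\<close> is at most twice the tail beyond \<open>\<bar>x\<bar>\<close> on either side, and
  the two bounds on \<open>f\<close> are the two tail estimates.
\<close>
theorem stein_solution:
  assumes cont: "continuous_on UNIV g" and bound: "\<And>x. \<bar>g x\<bar> \<le> 1"
  obtains f where "\<And>x. (f has_real_derivative x * f x + g x - normal_mean g) (at x)"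
    "\<And>x. \<bar>f x\<bar> \<le> 10" "\<And>x. \<bar>x * f x\<bar> \<le> 2"
proof -
  have meas: "g \<in> borel_measurable borel" using cont by (rule borel_measurable_continuous_onI)
  define k where "k u = std_normal_density u * (g u - normal_mean g)" for u
  have kb: "\<bar>k u\<bar> \<le> 2 * std_normal_density u" for u
  proof -
    have "\<bar>g u - normal_mean g\<bar> \<le> 2"
      using bound[of u] abs_normal_mean_le[OF meas bound] by linarith
    thus ?thesis using mult_left_mono[of "\<bar>g u - normal_mean g\<bar>" 2 "std_normal_density u"]
      by (simp add: k_def abs_mult mult.commute)
  qed
  have kmeas: "k \<in> borel_measurable borel" unfolding k_def using meas by measurable
  have kint: "integrable lborel k"
    by (rule Bochner_Integration.integrable_bound[OF integrable_mult_right[OF integrable_std_normal_density, of 2]])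
       (use kmeas kb in auto)
  have gint: "integrable lborel (\<lambda>u. std_normal_density u * g u)"
    by (rule Bochner_Integration.integrable_bound[OF integrable_std_normal_density])
       (use meas bound in \<open>auto simp: abs_mult intro!: AE_I2 mult_left_le\<close>)
  have k0: "(\<integral>u. k u \<partial>lborel) = 0"
    unfolding k_def right_diff_distrib
    using gint integrable_std_normal_density integral_std_normal_moment_even[of 0]
    by (simp add: normal_mean_lebesgue[OF meas])
  have kcont: "continuous_on UNIV k"
    unfolding k_def std_normal_density_def by (intro continuous_intros cont) auto
  have kint': "integrable lborel (\<lambda>u. indicator S u * k u)" if "S \<in> sets borel" for S
    using integrable_mult_indicator[OF _ kint, of S] that by simp
  define F where "F x = (\<integral>u. indicator {..x} u * k u \<partial>lborel)" for x
  have part: "\<bar>\<integral>u. indicator S u * k u \<partial>lborel\<bar> \<le> 2 * (\<integral>u. indicator T u * std_normal_density u \<partial>lborel)"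
    if "S \<in> sets borel" "T \<in> sets borel" "S \<subseteq> T" for S T
  proof -
    have "\<bar>\<integral>u. indicator S u * k u \<partial>lborel\<bar> \<le> (\<integral>u. \<bar>indicator S u * k u\<bar> \<partial>lborel)"
      by (rule integral_abs_bound)
    also have "\<dots> \<le> (\<integral>u. 2 * (indicator T u * std_normal_density u) \<partial>lborel)"
      using that kb
      by (intro integral_mono integrable_abs kint' integrable_mult_right integrable_tail)
         (auto simp: indicator_def)
    finally show ?thesis by simp
  qed
  have Fb: "\<bar>F x\<bar> \<le> 2 * upper_tail \<bar>x\<bar>" for x
  proof (cases "0 \<le> x")
    case True
    have "F x + (\<integral>u. indicator {x<..} u * k u \<partial>lborel) = (\<integral>u. indicator {..x} u * k u + indicator {x<..} u * k u \<partial>lborel)"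
      unfolding F_def by (intro Bochner_Integration.integral_add[symmetric] kint') auto
    also have "\<dots> = (\<integral>u. k u \<partial>lborel)"
      by (intro Bochner_Integration.integral_cong) (auto simp: indicator_def)
    finally have "F x = - (\<integral>u. indicator {x<..} u * k u \<partial>lborel)" using k0 by simp
    thus ?thesis using part[of "{x<..}" "{x..}"] True by (auto simp: upper_tail_def less_imp_le subset_iff)
  next
    case False
    thus ?thesis using part[of "{..x}" "{..x}"] by (simp add: F_def lower_tail_eq)
  qed
  define f where "f x = F x / std_normal_density x" for x
  have pos: "std_normal_density x > 0" for x by (simp add: normal_density_pos)
  have even: "std_normal_density \<bar>x\<bar> = std_normal_density x" for x
    by (simp add: std_normal_density_def)
  show thesis
  proof
    fix x
    have "(f has_real_derivative
        (k x * std_normal_density x - F x * (- x * std_normal_density x)) / (std_normal_density x * std_normal_density x)) (at x)"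
      unfolding f_def F_def
      using pos[of x]
      by (intro DERIV_divide DERIV_integral_atMost kint kcont has_derivative_std_normal_density) auto
    moreover have "(k x * std_normal_density x - F x * (- x * std_normal_density x)) / (std_normal_density x * std_normal_density x)
       = x * f x + g x - normal_mean g"
      using pos[of x] by (simp add: f_def k_def field_simps)
    ultimately show "(f has_real_derivative x * f x + g x - normal_mean g) (at x)" by simp
    show "\<bar>f x\<bar> \<le> 10"
      using Fb[of x] upper_tail_le_density[of "\<bar>x\<bar>"] pos[of x] by (simp add: f_def even field_simps)
    have "\<bar>x\<bar> * \<bar>F x\<bar> \<le> 2 * (\<bar>x\<bar> * upper_tail \<bar>x\<bar>)"
      using mult_left_mono[OF Fb[of x], of "\<bar>x\<bar>"] by simp
    also have "\<dots> \<le> 2 * std_normal_density x"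
      using upper_tail_mult_le[of "\<bar>x\<bar>"] even[of x] by simp
    finally show "\<bar>x * f x\<bar> \<le> 2" using pos[of x] by (simp add: f_def abs_mult field_simps)
  qed
qed

section \<open>Exchanging two values of a permutation\<close>

text \<open>
  Permutations and matrices each bring a function called \<open>transpose\<close>; this is the one on points.
\<close>
abbreviation swap :: "'i \<Rightarrow> 'i \<Rightarrow> 'i \<Rightarrow> 'i" where
  "swap \<equiv> Transposition.transpose"

definition perm_stat :: "'i set \<Rightarrow> ('i \<Rightarrow> 'i \<Rightarrow> real) \<Rightarrow> ('i \<Rightarrow> 'i) \<Rightarrow> real" where
  "perm_stat S a p = (\<Sum>i\<in>S. a i (p i))"

text \<open>
  The amount by which the statistic drops when the indices \<open>i\<close> and \<open>j\<close>, carrying the values \<open>k\<close>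
  and \<open>l\<close>, trade their values; see \<open>perm_stat_transpose\<close> below.
\<close>
definition exchange_gap :: "('i \<Rightarrow> 'i \<Rightarrow> real) \<Rightarrow> 'i \<Rightarrow> 'i \<Rightarrow> 'i \<Rightarrow> 'i \<Rightarrow> real" where
  "exchange_gap a i j k l = a i k + a j l - a i l - a j k"

lemma perm_stat_transpose:
  assumes "finite S" "i \<in> S" "j \<in> S"
  shows "perm_stat S a p - perm_stat S a (p \<circ> swap i j) = exchange_gap a i j (p i) (p j)"
proof (cases "i = j")
  case True
  then show ?thesis by (simp add: exchange_gap_def)
next
  case False
  have S: "S = insert i (insert j (S - {i,j}))" using assms by auto
  have rest: "(\<Sum>x\<in>S-{i,j}. a x (p (swap i j x))) = (\<Sum>x\<in>S-{i,j}. a x (p x))"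
    by (rule sum.cong) (auto simp: Transposition.transpose_def)
  have "perm_stat S a q = a i (q i) + a j (q j) + (\<Sum>x\<in>S-{i,j}. a x (q x))" for q
    unfolding perm_stat_def by (subst S, subst sum.insert) (use assms False in auto)
  from this[of p] this[of "p \<circ> swap i j"] show ?thesis
    using rest by (simp add: exchange_gap_def)
qed

text \<open>
  The linear regression property of the exchangeable pair, before averaging over permutations: the
  two cross terms of the gap are sums along rows and vanish. Pairs with \<open>i = j\<close> have gap zero, so
  they may stay in the sum.
\<close>
lemma sum_exchange_gap:
  assumes "p permutes S" "finite S" and rows: "\<And>i. i \<in> S \<Longrightarrow> (\<Sum>j\<in>S. a i j) = 0"
  shows "(\<Sum>i\<in>S. \<Sum>j\<in>S. exchange_gap a i j (p i) (p j)) = 2 * card S * perm_stat S a p"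
proof -
  have z: "(\<Sum>j\<in>S. a i (p j)) = 0" if "i \<in> S" for i
    using rows[OF that] sum.permute[OF assms(1), of "a i"] by (simp add: comp_def)
  have "(\<Sum>i\<in>S. \<Sum>j\<in>S. a i (p j)) = 0" using z by (simp add: sum.neutral)
  moreover have "(\<Sum>i\<in>S. \<Sum>j\<in>S. a j (p i)) = 0"
    by (subst sum.swap) (use z in \<open>simp add: sum.neutral\<close>)
  ultimately show ?thesis
    by (simp add: exchange_gap_def sum.distrib sum_subtractf perm_stat_def sum_distrib_left[symmetric])
qed

lemma sum_permutes_comp_transpose:
  assumes "i \<in> S" "j \<in> S"
  shows "(\<Sum>p | p permutes S. G (p \<circ> swap i j)) = (\<Sum>p | p permutes S. G p)"
proof -
  have t: "swap i j permutes S" using assms by (rule permutes_swap_id)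
  show ?thesis
    by (rule sum.reindex_bij_witness[where i = "\<lambda>p. p \<circ> swap i j" and j = "\<lambda>p. p \<circ> swap i j"])
       (auto simp: o_assoc[symmetric] intro: permutes_compose[OF t])
qed

text \<open>
  Composing with \<open>swap i j\<close> is a bijection of the permutations under which the gap changes its sign.
  The two halves of the difference therefore contribute equally, and regression evaluates the sum.
\<close>
lemma exchange_identity:
  fixes f :: "real \<Rightarrow> real"
  assumes "finite S" and rows: "\<And>i. i \<in> S \<Longrightarrow> (\<Sum>j\<in>S. a i j) = 0"
  shows "(\<Sum>i\<in>S. \<Sum>j\<in>S. \<Sum>p | p permutes S. exchange_gap a i j (p i) (p j) *
            (f (perm_stat S a p) - f (perm_stat S a (p \<circ> swap i j))))
         = 4 * card S * (\<Sum>p | p permutes S. perm_stat S a p * f (perm_stat S a p))"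
proof -
  let ?D = "\<lambda>i j p. exchange_gap a i j (p i) (p j)"
  have flip: "(\<Sum>p | p permutes S. ?D i j p * f (perm_stat S a (p \<circ> swap i j)))
      = - (\<Sum>p | p permutes S. ?D i j p * f (perm_stat S a p))" if "i \<in> S" "j \<in> S" for i j
  proof -
    have "?D i j p = - ?D i j (p \<circ> swap i j)" for p
      by (simp add: exchange_gap_def)
    hence "(\<Sum>p | p permutes S. ?D i j p * f (perm_stat S a (p \<circ> swap i j)))
       = - (\<Sum>p | p permutes S. ?D i j (p \<circ> swap i j) * f (perm_stat S a (p \<circ> swap i j)))"
      by (simp add: sum_negf)
    also have "\<dots> = - (\<Sum>p | p permutes S. ?D i j p * f (perm_stat S a p))"
      using sum_permutes_comp_transpose[OF that, of "\<lambda>p. ?D i j p * f (perm_stat S a p)"] by simp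
    finally show ?thesis .
  qed
  have "(\<Sum>i\<in>S. \<Sum>j\<in>S. \<Sum>p | p permutes S. ?D i j p *
            (f (perm_stat S a p) - f (perm_stat S a (p \<circ> swap i j))))
      = (\<Sum>i\<in>S. \<Sum>j\<in>S. \<Sum>p | p permutes S. 2 * (?D i j p * f (perm_stat S a p)))"
    by (rule sum.cong[OF refl], rule sum.cong[OF refl])
       (simp add: right_diff_distrib sum_subtractf flip sum_distrib_left[symmetric])
  also have "\<dots> = (\<Sum>p | p permutes S. \<Sum>i\<in>S. \<Sum>j\<in>S. 2 * (?D i j p * f (perm_stat S a p)))"
    by (subst sum.swap[of _ "{p. p permutes S}" S], subst sum.swap[of _ "{p. p permutes S}" S]) simp
  also have "\<dots> = (\<Sum>p | p permutes S. 2 * (\<Sum>i\<in>S. \<Sum>j\<in>S. ?D i j p) * f (perm_stat S a p))"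
    by (simp add: sum_distrib_left sum_distrib_right mult.assoc)
  also have "\<dots> = (\<Sum>p | p permutes S. 2 * (2 * card S * perm_stat S a p) * f (perm_stat S a p))"
    by (intro sum.cong refl) (simp add: sum_exchange_gap[OF _ assms])
  finally show ?thesis by (simp add: sum_distrib_left mult.assoc)
qed

text \<open>
  Forcing the value \<open>k\<close> at \<open>i\<close> by a swap of values is a \<open>card V\<close>-to-one map: on each class
  \<open>q i = m\<close> it is composition with the fixed involution \<open>swap k m\<close>, which maps that class
  bijectively onto the class \<open>q i = k\<close>. The set \<open>Q\<close> is kept general so that the lemma can be applied
  a second time to permutations that already have one value prescribed.
\<close>
lemma sum_redirect:
  assumes "finite Q" "finite V" "k \<in> V"
    and val: "\<And>q. q \<in> Q \<Longrightarrow> q i \<in> V"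
    and closed: "\<And>q m. q \<in> Q \<Longrightarrow> m \<in> V \<Longrightarrow> swap k m \<circ> q \<in> Q"
  shows "(\<Sum>q\<in>Q. G (swap k (q i) \<circ> q)) = real (card V) * (\<Sum>q\<in>{q\<in>Q. q i = k}. G q)"
proof -
  have "(\<Sum>q\<in>Q. G (swap k (q i) \<circ> q))
      = (\<Sum>m\<in>V. \<Sum>q\<in>{q\<in>Q. q i = m}. G (swap k (q i) \<circ> q))"
    by (rule sum.group[symmetric]) (use assms in auto)
  also have "\<dots> = (\<Sum>m\<in>V. \<Sum>q\<in>{q\<in>Q. q i = k}. G q)"
  proof (rule sum.cong[OF refl])
    fix m assume "m \<in> V"
    show "(\<Sum>q\<in>{q\<in>Q. q i = m}. G (swap k (q i) \<circ> q)) = (\<Sum>q\<in>{q\<in>Q. q i = k}. G q)"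
      by (rule sum.reindex_bij_witness[where i = "\<lambda>q. swap k m \<circ> q" and j = "\<lambda>q. swap k m \<circ> q"])
         (use closed \<open>m \<in> V\<close> in \<open>auto simp: o_assoc\<close>)
  qed
  finally show ?thesis by simp
qed

definition redirect :: "'i \<Rightarrow> 'i \<Rightarrow> ('i \<Rightarrow> 'i) \<Rightarrow> 'i \<Rightarrow> 'i" where
  "redirect i k p = swap k (p i) \<circ> p"

lemma redirect_permutes:
  assumes "p permutes S" "i \<in> S" "k \<in> S"
  shows "redirect i k p permutes S"
proof -
  have "p i \<in> S" using assms by (simp add: permutes_in_image)
  thus ?thesis unfolding redirect_def
    by (intro permutes_compose[OF assms(1)] permutes_swap_id assms)
qed

text \<open>
  Redirecting at two indices sends the uniform distribution on all permutations to the uniform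
  distribution on those with two prescribed values.
\<close>
lemma sum_redirect_twice:
  assumes "finite S" "i \<in> S" "j \<in> S" "i \<noteq> j" "k \<in> S" "l \<in> S" "k \<noteq> l"
  shows "(\<Sum>p | p permutes S. G (redirect j l (redirect i k p)))
     = real (card S) * real (card S - 1) * (\<Sum>p | p permutes S \<and> p i = k \<and> p j = l. G p)"
proof -
  have fin: "finite {p. p permutes S}" using assms by (simp add: finite_permutations)
  have "(\<Sum>p | p permutes S. G (redirect j l (redirect i k p)))
     = real (card S) * (\<Sum>p\<in>{p\<in>{p. p permutes S}. p i = k}. G (swap l (p j) \<circ> p))"
    unfolding redirect_def
    by (rule sum_redirect[where G = "\<lambda>q. G (swap l (q j) \<circ> q)"])
       (use assms fin in \<open>auto simp: permutes_in_image intro!: permutes_compose permutes_swap_id\<close>)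
  also have "(\<Sum>p\<in>{p\<in>{p. p permutes S}. p i = k}. G (swap l (p j) \<circ> p))
     = real (card (S - {k})) * (\<Sum>p\<in>{p\<in>{p\<in>{p. p permutes S}. p i = k}. p j = l}. G p)"
  proof (rule sum_redirect)
    show "q j \<in> S - {k}" if "q \<in> {p\<in>{p. p permutes S}. p i = k}" for q
    proof -
      have "inj q" using that permutes_inj by auto
      hence "q j \<noteq> q i" using assms by (auto dest: injD)
      thus ?thesis using that assms by (auto simp: permutes_in_image)
    qed
    show "swap l m \<circ> q \<in> {p\<in>{p. p permutes S}. p i = k}"
      if "q \<in> {p\<in>{p. p permutes S}. p i = k}" "m \<in> S - {k}" for q m
      using that assms by (auto simp: Transposition.transpose_def intro!: permutes_compose permutes_swap_id)
  qed (use assms fin in auto)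
  finally show ?thesis using assms
    by (simp add: conj_assoc cong: conj_cong)
qed

text \<open>
  Only four indices can be affected: the two whose values are prescribed, and the two which carried
  these values before.
\<close>
lemma redirect_twice_eq:
  assumes "inj p" "x \<noteq> i" "x \<noteq> j" "p x \<noteq> k" "p x \<noteq> l"
  shows "redirect j l (redirect i k p) x = p x"
proof -
  have "p x \<noteq> p i" using assms by (auto dest: injD)
  hence x: "redirect i k p x = p x" using assms by (simp add: redirect_def)
  have "inj (redirect i k p)" unfolding redirect_def
    by (intro inj_compose assms(1)) simp
  hence "redirect i k p j \<noteq> p x" using assms(3) x by (metis injD)
  thus ?thesis unfolding redirect_def[of j l] using assms x by simp
qed

text \<open>
  A change at four indices costs at most \<open>2 C\<close> at each of them.
\<close>
lemma perm_stat_local_change: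
  assumes "finite S" "p permutes S" "q permutes S"
    and bound: "\<And>i j. i \<in> S \<Longrightarrow> j \<in> S \<Longrightarrow> \<bar>a i j\<bar> \<le> C"
    and eq: "\<And>x. x \<noteq> i \<Longrightarrow> x \<noteq> j \<Longrightarrow> p x \<noteq> k \<Longrightarrow> p x \<noteq> l \<Longrightarrow> q x = p x"
    and "i \<in> S"
  shows "\<bar>perm_stat S a q - perm_stat S a p\<bar> \<le> 8 * C"
proof -
  have C: "0 \<le> C" using bound[OF \<open>i \<in> S\<close> \<open>i \<in> S\<close>] by linarith
  define E where "E = S \<inter> {i, j, inv p k, inv p l}"
  have out: "a x (q x) - a x (p x) = 0" if "x \<in> S - E" for x
  proof -
    have "p x \<noteq> k" "p x \<noteq> l" using that assms(2) permutes_inverses(2)[OF assms(2)]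
      by (auto simp: E_def)
    thus ?thesis using eq[of x] that by (auto simp: E_def)
  qed
  have "perm_stat S a q - perm_stat S a p = (\<Sum>x\<in>S. a x (q x) - a x (p x))"
    by (simp add: perm_stat_def sum_subtractf)
  also have "\<dots> = (\<Sum>x\<in>E. a x (q x) - a x (p x))"
    by (rule sum.mono_neutral_right) (use assms out in \<open>auto simp: E_def\<close>)
  also have "\<bar>\<dots>\<bar> \<le> (\<Sum>x\<in>E. \<bar>a x (q x) - a x (p x)\<bar>)" by (rule sum_abs)
  also have "\<dots> \<le> (\<Sum>x\<in>E. 2 * C)"
  proof (rule sum_mono)
    fix x assume "x \<in> E"
    hence "x \<in> S" by (simp add: E_def)
    hence "p x \<in> S" "q x \<in> S" using assms by (auto simp: permutes_in_image)
    from bound[OF \<open>x \<in> S\<close> this(1)] bound[OF \<open>x \<in> S\<close> this(2)]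
    show "\<bar>a x (q x) - a x (p x)\<bar> \<le> 2 * C" by linarith
  qed
  also have "\<dots> = real (card E) * (2 * C)" by simp
  also have "\<dots> \<le> 4 * (2 * C)"
  proof (rule mult_right_mono)
    have "card E \<le> card {i, j, inv p k, inv p l}" unfolding E_def by (intro card_mono) auto
    also have "\<dots> \<le> 4" by (auto simp: card_insert_if)
    finally show "real (card E) \<le> 4" by simp
  qed (use C in simp)
  finally show ?thesis by simp
qed

lemma dist_closed_segment_le:
  fixes x y z w :: real
  assumes "z \<in> closed_segment x y" "\<bar>x - w\<bar> \<le> r" "\<bar>y - w\<bar> \<le> r"
  shows "\<bar>z - w\<bar> \<le> r"
  using assms by (auto simp: closed_segment_eq_real_ivl split: if_splits)

text \<open>
  The mean value theorem for both orders of the end points, including the case where they coincide.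
\<close>
lemma mvt_closed_segment:
  fixes f f' :: "real \<Rightarrow> real"
  assumes "\<And>x. (f has_real_derivative f' x) (at x)"
  shows "\<exists>\<xi>\<in>closed_segment x y. f x - f y = (x - y) * f' \<xi>"
proof -
  have main: "\<exists>\<xi>\<in>{u..v}. f v - f u = (v - u) * f' \<xi>" if "u < v" for u v
    using MVT2[OF that, of f f'] assms by (auto intro: less_imp_le)
  consider "x < y" | "x = y" | "y < x" by linarith
  thus ?thesis
  proof cases
    case 1 then obtain \<xi> where "\<xi>\<in>{x..y}" "f y - f x = (y - x) * f' \<xi>" using main by blast
    then show ?thesis using 1 by (intro bexI[of _ \<xi>]) (auto simp: closed_segment_eq_real_ivl algebra_simps)
  next
    case 3 then obtain \<xi> where "\<xi>\<in>{y..x}" "f x - f y = (x - y) * f' \<xi>" using main by blast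
    then show ?thesis using 3 by (intro bexI[of _ \<xi>]) (auto simp: closed_segment_eq_real_ivl)
  qed auto
qed

text \<open>
  The mean value theorem turns each summand into a squared gap times a value of \<open>f'\<close> at a point
  between the values of the statistic before and after the exchange. Grouping the permutations by the
  values \<open>(k, l)\<close> which they take at \<open>(i, j)\<close> makes the squared gap constant on each group, and the
  average over a group is an average over all permutations after redirecting. There the intermediate
  point is within \<open>8 C\<close> of the original value of the statistic. The number \<open>v\<close> is the total weight.
\<close>
lemma exchange_sum_approx:
  assumes "finite S" "card S \<ge> 2"
    and bound: "\<And>i j. i \<in> S \<Longrightarrow> j \<in> S \<Longrightarrow> \<bar>a i j\<bar> \<le> C"
    and deriv: "\<And>x. (f has_real_derivative f' x) (at x)"
    and modulus: "\<And>x y. \<bar>x - y\<bar> \<le> 8 * C \<Longrightarrow> \<bar>f' x - f' y\<bar> \<le> K x"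
  defines "v \<equiv> (\<Sum>(i,j)\<in>{(i,j)\<in>S\<times>S. i \<noteq> j}. \<Sum>(k,l)\<in>{(k,l)\<in>S\<times>S. k \<noteq> l}.
                 (exchange_gap a i j k l)\<^sup>2) / (real (card S) * real (card S - 1))"
  shows "\<bar>(\<Sum>i\<in>S. \<Sum>j\<in>S. \<Sum>p | p permutes S. exchange_gap a i j (p i) (p j) *
            (f (perm_stat S a p) - f (perm_stat S a (p \<circ> swap i j))))
         - v * (\<Sum>p | p permutes S. f' (perm_stat S a p))\<bar>
      \<le> v * (\<Sum>p | p permutes S. K (perm_stat S a p))"
proof -
  define R where "R = {(i,j)\<in>S\<times>S. i \<noteq> j}"
  let ?P = "{p. p permutes S}"
  let ?Y = "perm_stat S a"
  have finR: "finite R" unfolding R_def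
    by (rule finite_subset[of _ "S \<times> S"]) (use assms(1) in auto)
  have finP: "finite ?P" using assms by (simp add: finite_permutations)
  define N where "N = real (card S) * real (card S - 1)"
  have N: "N > 0" using assms(2) by (simp add: N_def)
  have "\<exists>\<xi>. \<forall>p i j. \<xi> p i j \<in> closed_segment (?Y p) (?Y (p \<circ> swap i j)) \<and>
      f (?Y p) - f (?Y (p \<circ> swap i j)) = (?Y p - ?Y (p \<circ> swap i j)) * f' (\<xi> p i j)"
    using mvt_closed_segment[of f f', OF deriv]
    by (intro choice allI) (simp add: Bex_def)
  then obtain \<xi> where seg: "\<And>p i j. \<xi> p i j \<in> closed_segment (?Y p) (?Y (p \<circ> swap i j))"
    and mvt: "\<And>p i j. f (?Y p) - f (?Y (p \<circ> swap i j))
                 = (?Y p - ?Y (p \<circ> swap i j)) * f' (\<xi> p i j)" by blast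
  define T where "T = (\<Sum>i\<in>S. \<Sum>j\<in>S. \<Sum>p\<in>?P. exchange_gap a i j (p i) (p j) *
            (f (?Y p) - f (?Y (p \<circ> swap i j))))"
  have "T = (\<Sum>(i,j)\<in>S\<times>S. \<Sum>p\<in>?P. exchange_gap a i j (p i) (p j) *
            (f (?Y p) - f (?Y (p \<circ> swap i j))))"
    unfolding T_def by (rule sum.cartesian_product)
  also have "\<dots> = (\<Sum>(i,j)\<in>R. \<Sum>p\<in>?P. exchange_gap a i j (p i) (p j) *
            (f (?Y p) - f (?Y (p \<circ> swap i j))))"
    by (rule sum.mono_neutral_right) (use assms in \<open>auto simp: R_def\<close>)
  also have "\<dots> = (\<Sum>(i,j)\<in>R. \<Sum>(k,l)\<in>R. (exchange_gap a i j k l)\<^sup>2 *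
           (\<Sum>p | p permutes S \<and> p i = k \<and> p j = l. f' (\<xi> p i j)))"
  proof (rule sum.cong[OF refl], clarify)
    fix i j assume "(i,j) \<in> R"
    hence ij: "i \<in> S" "j \<in> S" "i \<noteq> j" by (auto simp: R_def)
    have "(\<Sum>p\<in>?P. exchange_gap a i j (p i) (p j) * (f (?Y p) - f (?Y (p \<circ> swap i j))))
       = (\<Sum>p\<in>?P. (exchange_gap a i j (p i) (p j))\<^sup>2 * f' (\<xi> p i j))"
      by (simp add: mvt perm_stat_transpose[OF assms(1) ij(1,2)] power2_eq_square mult.assoc)
    also have "\<dots> = (\<Sum>kl\<in>R. \<Sum>p\<in>{p\<in>?P. (p i, p j) = kl}.
                 (exchange_gap a i j (p i) (p j))\<^sup>2 * f' (\<xi> p i j))"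
    proof (rule sum.group[symmetric])
      show "(\<lambda>p. (p i, p j)) ` ?P \<subseteq> R"
        using ij by (auto simp: R_def permutes_in_image dest: permutes_inj injD)
    qed (use finP finR in auto)
    also have "\<dots> = (\<Sum>(k,l)\<in>R. (exchange_gap a i j k l)\<^sup>2 *
           (\<Sum>p | p permutes S \<and> p i = k \<and> p j = l. f' (\<xi> p i j)))"
      by (rule sum.cong[OF refl], clarify) (simp add: sum_distrib_left)
    finally show "(\<Sum>p\<in>?P. exchange_gap a i j (p i) (p j) * (f (?Y p) - f (?Y (p \<circ> swap i j))))
      = (\<Sum>(k,l)\<in>R. (exchange_gap a i j k l)\<^sup>2 *
           (\<Sum>p | p permutes S \<and> p i = k \<and> p j = l. f' (\<xi> p i j)))" .
  qed
  finally have T: "T = (\<Sum>(i,j)\<in>R. \<Sum>(k,l)\<in>R. (exchange_gap a i j k l)\<^sup>2 *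
           (\<Sum>p | p permutes S \<and> p i = k \<and> p j = l. f' (\<xi> p i j)))" .
  have v: "v = (\<Sum>(i,j)\<in>R. \<Sum>(k,l)\<in>R. (exchange_gap a i j k l)\<^sup>2 / N)"
    unfolding v_def R_def[symmetric] N_def by (simp add: sum_divide_distrib case_prod_unfold)
  have block: "\<bar>(\<Sum>p | p permutes S \<and> p i = k \<and> p j = l. f' (\<xi> p i j)) - (\<Sum>p\<in>?P. f' (?Y p)) / N\<bar>
       \<le> (\<Sum>p\<in>?P. K (?Y p)) / N" if "(i,j) \<in> R" "(k,l) \<in> R" for i j k l
  proof -
    have ij: "i \<in> S" "j \<in> S" "i \<noteq> j" "k \<in> S" "l \<in> S" "k \<noteq> l" using that by (auto simp: R_def)
    define \<Phi> where "\<Phi> p = redirect j l (redirect i k p)" for p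
    have "(\<Sum>p | p permutes S \<and> p i = k \<and> p j = l. f' (\<xi> p i j)) = (\<Sum>p\<in>?P. f' (\<xi> (\<Phi> p) i j)) / N"
      using sum_redirect_twice[OF assms(1) ij, of "\<lambda>p. f' (\<xi> p i j)"] N
      unfolding N_def[symmetric] by (simp add: \<Phi>_def)
    moreover have "\<bar>(\<Sum>p\<in>?P. f' (\<xi> (\<Phi> p) i j)) - (\<Sum>p\<in>?P. f' (?Y p))\<bar> \<le> (\<Sum>p\<in>?P. K (?Y p))"
    proof -
      have "\<bar>f' (\<xi> (\<Phi> p) i j) - f' (?Y p)\<bar> \<le> K (?Y p)" if "p \<in> ?P" for p
      proof -
        have p: "p permutes S" using that by simp
        have q: "\<Phi> p permutes S" unfolding \<Phi>_def by (intro redirect_permutes p ij)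
        \<comment> \<open>Exchanging \<open>i\<close> and \<open>j\<close> changes nothing outside the four indices, so the whole segment stays close.\<close>
        have q': "\<Phi> p \<circ> swap i j permutes S"
          by (intro permutes_compose[OF _ q] permutes_swap_id ij)
        have e: "\<Phi> p x = p x" if "x \<noteq> i" "x \<noteq> j" "p x \<noteq> k" "p x \<noteq> l" for x
          unfolding \<Phi>_def by (rule redirect_twice_eq[OF permutes_inj[OF p] that])
        have 1: "\<bar>?Y (\<Phi> p) - ?Y p\<bar> \<le> 8 * C"
          by (rule perm_stat_local_change[OF assms(1) p q bound _ ij(1), where j = j and k = k and l = l]) (auto intro: e)
        have 2: "\<bar>?Y (\<Phi> p \<circ> swap i j) - ?Y p\<bar> \<le> 8 * C"
          by (rule perm_stat_local_change[OF assms(1) p q' bound _ ij(1), where j = j and k = k and l = l]) (auto intro: e)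
        have "\<bar>\<xi> (\<Phi> p) i j - ?Y p\<bar> \<le> 8 * C"
          by (rule dist_closed_segment_le[OF seg 1 2])
        thus ?thesis using modulus[of "?Y p" "\<xi> (\<Phi> p) i j"] by (simp add: abs_minus_commute)
      qed
      thus ?thesis unfolding sum_subtractf[symmetric] by (intro order.trans[OF sum_abs] sum_mono)
    qed
    ultimately show ?thesis using N by (simp add: diff_divide_distrib[symmetric] divide_right_mono)
  qed
  have "T - v * (\<Sum>p\<in>?P. f' (?Y p)) = (\<Sum>(i,j)\<in>R. \<Sum>(k,l)\<in>R. (exchange_gap a i j k l)\<^sup>2 *
      ((\<Sum>p | p permutes S \<and> p i = k \<and> p j = l. f' (\<xi> p i j)) - (\<Sum>p\<in>?P. f' (?Y p)) / N))"
    unfolding T v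
    by (simp add: sum_distrib_right sum_subtractf right_diff_distrib case_prod_unfold)
  also have "\<bar>\<dots>\<bar> \<le> (\<Sum>(i,j)\<in>R. \<Sum>(k,l)\<in>R. (exchange_gap a i j k l)\<^sup>2 * ((\<Sum>p\<in>?P. K (?Y p)) / N))"
    unfolding case_prod_unfold
    by (intro order.trans[OF sum_abs] sum_mono)
       (auto simp: abs_mult simp del: times_divide_eq_right intro!: mult_left_mono block)
  also have "\<dots> = v * (\<Sum>p\<in>?P. K (?Y p))"
    unfolding v by (simp add: sum_distrib_right case_prod_unfold)
  finally show ?thesis unfolding T_def .
qed

text \<open>
  The weight in the preceding lemma is found without computing it: for \<open>f x = x\<close> the derivative is
  constant, the approximation is exact, and the unit variance gives \<open>v = 4 * card S\<close>.
\<close>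
theorem permutation_stein_bound:
  assumes "finite S" "card S \<ge> 2" and rows: "\<And>i. i \<in> S \<Longrightarrow> (\<Sum>j\<in>S. a i j) = 0"
    and bound: "\<And>i j. i \<in> S \<Longrightarrow> j \<in> S \<Longrightarrow> \<bar>a i j\<bar> \<le> C"
    and norm: "(\<Sum>p | p permutes S. (perm_stat S a p)\<^sup>2) = card {p. p permutes S}"
    and deriv: "\<And>x. (f has_real_derivative f' x) (at x)"
    and modulus: "\<And>x y. \<bar>x - y\<bar> \<le> 8 * C \<Longrightarrow> \<bar>f' x - f' y\<bar> \<le> K x"
  shows "\<bar>\<Sum>p | p permutes S. f' (perm_stat S a p) - perm_stat S a p * f (perm_stat S a p)\<bar>
      \<le> (\<Sum>p | p permutes S. K (perm_stat S a p))"
proof -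
  let ?P = "{p. p permutes S}"
  let ?Y = "perm_stat S a"
  define v where "v = (\<Sum>(i,j)\<in>{(i,j)\<in>S\<times>S. i \<noteq> j}. \<Sum>(k,l)\<in>{(k,l)\<in>S\<times>S. k \<noteq> l}.
                 (exchange_gap a i j k l)\<^sup>2) / (real (card S) * real (card S - 1))"
  have cP: "real (card ?P) > 0" using assms(1) by (simp add: card_permutations)
  have n: "real (card S) > 0" using assms(2) by simp
  have approx: "\<bar>4 * card S * (\<Sum>p\<in>?P. ?Y p * F (?Y p)) - v * (\<Sum>p\<in>?P. F' (?Y p))\<bar>
     \<le> v * (\<Sum>p\<in>?P. L (?Y p))"
    if "\<And>x. (F has_real_derivative F' x) (at x)"
       "\<And>x y. \<bar>x - y\<bar> \<le> 8 * C \<Longrightarrow> \<bar>F' x - F' y\<bar> \<le> L x" for F F' L :: "real \<Rightarrow> real"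
  proof -
    have "(\<Sum>i\<in>S. \<Sum>j\<in>S. \<Sum>p\<in>?P. exchange_gap a i j (p i) (p j) * (F (?Y p) - F (?Y (p \<circ> swap i j))))
       = 4 * card S * (\<Sum>p\<in>?P. ?Y p * F (?Y p))"
      using assms(1) rows by (rule exchange_identity)
    moreover have "\<bar>(\<Sum>i\<in>S. \<Sum>j\<in>S. \<Sum>p\<in>?P. exchange_gap a i j (p i) (p j) * (F (?Y p) - F (?Y (p \<circ> swap i j))))
         - v * (\<Sum>p\<in>?P. F' (?Y p))\<bar> \<le> v * (\<Sum>p\<in>?P. L (?Y p))"
      unfolding v_def using assms(1,2) bound that by (rule exchange_sum_approx)
    ultimately show ?thesis by simp
  qed
  have "4 * card S * (\<Sum>p\<in>?P. ?Y p * ?Y p) - v * card ?P = 0"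
    using approx[of "\<lambda>x. x" "\<lambda>_. 1" "\<lambda>_. 0"] by simp
  hence "4 * card S * card ?P = v * card ?P" using norm by (simp add: power2_eq_square)
  hence v: "v = 4 * card S" using cP by simp
  have "4 * real (card S) * \<bar>\<Sum>p\<in>?P. f' (?Y p) - ?Y p * f (?Y p)\<bar>
     = \<bar>4 * card S * (\<Sum>p\<in>?P. ?Y p * f (?Y p)) - v * (\<Sum>p\<in>?P. f' (?Y p))\<bar>"
    unfolding v sum_subtractf right_diff_distrib[symmetric] abs_mult
    using n by (simp add: abs_minus_commute)
  also have "\<dots> \<le> 4 * real (card S) * (\<Sum>p\<in>?P. K (?Y p))"
    using approx[OF deriv modulus] by (simp add: v)
  finally show ?thesis using n by simp
qed

text \<open>
  The exchange identity for a constant function says that the statistic has mean zero.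
\<close>
lemma sum_perm_stat:
  assumes "finite S" "S \<noteq> {}" and rows: "\<And>i. i \<in> S \<Longrightarrow> (\<Sum>j\<in>S. a i j) = 0"
  shows "(\<Sum>p | p permutes S. perm_stat S a p) = 0"
  using exchange_identity[where a = a and f = "\<lambda>_. 1", OF assms(1)] rows assms(1,2) by simp

section \<open>Envelopes and window averages\<close>

text \<open>
  A smoothing whose modulus of continuity is controlled by the local oscillation of \<open>k\<close>, and not
  only by its supremum norm.
\<close>
definition window_average :: "real \<Rightarrow> (real \<Rightarrow> real) \<Rightarrow> real \<Rightarrow> real" where
  "window_average e k x = (\<integral>u. indicator {x - e..x + e} u * k u \<partial>lborel) / (2 * e)"

lemma integrable_interval: "integrable lborel (indicator {a..b::real} :: real \<Rightarrow> real)"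
  by (rule integrable_real_indicator) (auto simp: emeasure_lborel_Icc_eq)

lemma integrable_window:
  fixes k :: "real \<Rightarrow> real"
  assumes "k \<in> borel_measurable borel" "\<And>x. \<bar>k x\<bar> \<le> B"
  shows "integrable lborel (\<lambda>u. indicator {a..b} u * k u)"
proof (rule Bochner_Integration.integrable_bound)
  show "integrable lborel (\<lambda>u. B * indicator {a..b} u :: real)"
    by (intro integrable_mult_right integrable_interval)
  have "0 \<le> B" using assms(2)[of 0] by linarith
  thus "AE u in lborel. norm (indicator {a..b} u * k u) \<le> norm (B * indicator {a..b} u)"
    using assms(2) by (auto simp: indicator_def intro!: AE_I2)
qed (use assms in auto)

lemma window_average_bounds:
  assumes "0 < e" "k \<in> borel_measurable borel" "\<And>x. \<bar>k x\<bar> \<le> 1"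
    and lu: "\<And>u. \<bar>u - x\<bar> \<le> e \<Longrightarrow> L \<le> k u \<and> k u \<le> U"
  shows "L \<le> window_average e k x" "window_average e k x \<le> U"
proof -
  have "(\<integral>u. indicator {x - e..x + e} u * L \<partial>lborel) \<le> (\<integral>u. indicator {x - e..x + e} u * k u \<partial>lborel)"
    by (intro integral_mono integrable_window[OF assms(2,3)] integrable_mult_left integrable_interval)
       (use lu in \<open>auto simp: indicator_def\<close>)
  moreover have "(\<integral>u. indicator {x - e..x + e} u * k u \<partial>lborel) \<le> (\<integral>u. indicator {x - e..x + e} u * U \<partial>lborel)"
    by (intro integral_mono integrable_window[OF assms(2,3)] integrable_mult_left integrable_interval)
       (use lu in \<open>auto simp: indicator_def\<close>)
  ultimately show "L \<le> window_average e k x" "window_average e k x \<le> U"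
    using assms(1) by (auto simp: window_average_def field_simps)
qed

text \<open>
  Two windows of the same width have the same mass, so \<open>k\<close> may be centred at the midpoint of
  \<open>[L, U]\<close>. The difference then lives on the two strips where the windows disagree, each of width
  \<open>\<bar>x - y\<bar>\<close>, and is bounded there by \<open>(U - L) / 2\<close>.
\<close>
lemma window_average_modulus:
  assumes e: "0 < e" and meas: "k \<in> borel_measurable borel" and b: "\<And>x. \<bar>k x\<bar> \<le> 1"
    and lu: "\<And>u. \<bar>u - x\<bar> \<le> e + \<bar>x - y\<bar> \<Longrightarrow> L \<le> k u \<and> k u \<le> U"
  shows "\<bar>window_average e k x - window_average e k y\<bar> \<le> \<bar>x - y\<bar> * (U - L) / (2 * e)"
proof -
  have ordered: "\<bar>window_average e k s - window_average e k t\<bar> \<le> (t - s) * (U - L) / (2 * e)"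
    if "s \<le> t" and lu': "\<And>u. s - e \<le> u \<Longrightarrow> u \<le> t + e \<Longrightarrow> L \<le> k u \<and> k u \<le> U" for s t
  proof -
    define c where "c = (U + L) / 2"
    have dev: "\<bar>k u - c\<bar> \<le> (U - L) / 2" if "s - e \<le> u" "u \<le> t + e" for u
      using lu'[OF that] by (auto simp: c_def abs_le_iff field_simps)
    have UL: "L \<le> U" using lu'[of s] e \<open>s \<le> t\<close> by auto
    have int: "integrable lborel (\<lambda>u. indicator {r..r'} u * (k u - c))" for r r'
      by (rule integrable_window[where B = "1 + \<bar>c\<bar>"])
         (use meas in \<open>auto intro: order.trans[OF abs_triangle_ineq4] add_mono b\<close>)
    have centre: "(\<integral>u. indicator {r - e..r + e} u * (k u - c) \<partial>lborel) = 2 * e * window_average e k r - 2 * e * c" for r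
    proof -
      have "(\<integral>u. indicator {r - e..r + e} u * (k u - c) \<partial>lborel)
         = (\<integral>u. indicator {r - e..r + e} u * k u - indicator {r - e..r + e} u * c \<partial>lborel)"
        by (simp add: right_diff_distrib)
      also have "\<dots> = (\<integral>u. indicator {r - e..r + e} u * k u \<partial>lborel) - 2 * e * c"
        using e by (subst Bochner_Integration.integral_diff[OF integrable_window[OF meas b]])
            (auto intro!: integrable_mult_left integrable_interval)
      finally show ?thesis using e by (simp add: window_average_def)
    qed
    have "2 * e * \<bar>window_average e k s - window_average e k t\<bar>
      = \<bar>2 * e * window_average e k s - 2 * e * window_average e k t\<bar>"
      using e by (simp add: right_diff_distrib[symmetric] abs_mult)
    also have "\<dots> = \<bar>(\<integral>u. indicator {s - e..s + e} u * (k u - c) \<partial>lborel) - (\<integral>u. indicator {t - e..t + e} u * (k u - c) \<partial>lborel)\<bar>"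
      by (simp add: centre)
    also have "\<dots> = \<bar>\<integral>u. indicator {s - e..s + e} u * (k u - c) - indicator {t - e..t + e} u * (k u - c) \<partial>lborel\<bar>"
      by (subst Bochner_Integration.integral_diff[OF int int]) simp
    also have "\<dots> \<le> (\<integral>u. \<bar>indicator {s - e..s + e} u * (k u - c) - indicator {t - e..t + e} u * (k u - c)\<bar> \<partial>lborel)"
      by (rule integral_abs_bound)
    also have "\<dots> \<le> (\<integral>u. (U - L) / 2 * indicator {s - e..t - e} u + (U - L) / 2 * indicator {s + e..t + e} u \<partial>lborel)"
    proof (rule integral_mono)
      show "integrable lborel (\<lambda>u. (U - L) / 2 * indicator {s - e..t - e} u + (U - L) / 2 * indicator {s + e..t + e} u)"
        by (intro Bochner_Integration.integrable_add integrable_mult_right integrable_interval)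
      show "integrable lborel (\<lambda>u. \<bar>indicator {s - e..s + e} u * (k u - c) - indicator {t - e..t + e} u * (k u - c)\<bar>)"
        by (intro integrable_abs Bochner_Integration.integrable_diff int)
      fix u
      show "\<bar>indicator {s - e..s + e} u * (k u - c) - indicator {t - e..t + e} u * (k u - c)\<bar>
        \<le> (U - L) / 2 * indicator {s - e..t - e} u + (U - L) / 2 * indicator {s + e..t + e} u"
      proof (cases "s - e \<le> u \<and> u \<le> t + e")
        case True
        define D where "D = (U - L) / 2"
        have "\<bar>k u - c\<bar> \<le> D" "0 \<le> D" using dev True UL by (auto simp: D_def)
        thus ?thesis using \<open>s \<le> t\<close> e True unfolding D_def[symmetric]
          by (auto simp: indicator_def abs_minus_commute)
      next
        case False
        thus ?thesis using \<open>s \<le> t\<close> e by (auto simp: indicator_def)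
      qed
    qed
    also have "\<dots> = (U - L) * (t - s)"
      using \<open>s \<le> t\<close> by (subst Bochner_Integration.integral_add)
          (auto simp: field_simps intro!: integrable_mult_right integrable_interval)
    finally show ?thesis using e by (simp add: field_simps)
  qed
  show ?thesis
  proof (cases "x \<le> y")
    case True
    show ?thesis using ordered[OF True] lu True by (auto simp: abs_le_iff)
  next
    case False
    have "\<bar>window_average e k y - window_average e k x\<bar> \<le> (x - y) * (U - L) / (2 * e)"
      using False lu by (intro ordered) (auto simp: abs_le_iff)
    thus ?thesis using False by (simp add: abs_minus_commute)
  qed
qed

lemma continuous_window_average:
  assumes "0 < e" "k \<in> borel_measurable borel" "\<And>x. \<bar>k x\<bar> \<le> 1"
  shows "continuous_on UNIV (window_average e k)"
proof (rule continuous_on_subset[OF lipschitz_on_continuous_on])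
  show "(1 / e)-lipschitz_on UNIV (window_average e k)"
  proof (rule lipschitz_onI)
    fix x y
    have "\<bar>window_average e k x - window_average e k y\<bar> \<le> \<bar>x - y\<bar> * (1 - (-1)) / (2 * e)"
      using assms(3) by (intro window_average_modulus assms) (auto simp: abs_le_iff minus_le_iff)
    thus "dist (window_average e k x) (window_average e k y) \<le> 1 / e * dist x y"
      by (simp add: dist_real_def)
  qed (use assms in simp)
qed simp

lemma upper_env_ge:
  assumes "\<And>x. \<bar>h x\<bar> \<le> 1" "\<bar>u - x\<bar> \<le> e"
  shows "h u \<le> upper_env e h x"
proof -
  have "h (x + (u - x)) \<le> upper_env e h x" unfolding upper_env_def
    by (rule cSUP_upper) (use assms in \<open>auto simp: abs_le_iff intro!: bdd_aboveI[of _ 1]\<close>)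
  thus ?thesis by simp
qed

lemma lower_env_le:
  assumes "\<And>x. \<bar>h x\<bar> \<le> 1" "\<bar>u - x\<bar> \<le> e"
  shows "lower_env e h x \<le> h u"
proof -
  have "lower_env e h x \<le> h (x + (u - x))" unfolding lower_env_def
    by (rule cINF_lower) (use assms in \<open>auto simp: abs_le_iff minus_le_iff intro!: bdd_belowI[of _ "-1"]\<close>)
  thus ?thesis by simp
qed

lemma upper_env_least:
  assumes "0 \<le> e" "\<And>u. \<bar>u - x\<bar> \<le> e \<Longrightarrow> h u \<le> c"
  shows "upper_env e h x \<le> c"
  unfolding upper_env_def by (rule cSUP_least) (use assms in \<open>auto intro!: exI[of _ 0]\<close>)

lemma lower_env_greatest:
  assumes "0 \<le> e" "\<And>u. \<bar>u - x\<bar> \<le> e \<Longrightarrow> c \<le> h u"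
  shows "c \<le> lower_env e h x"
  unfolding lower_env_def by (rule cINF_greatest) (use assms in \<open>auto intro!: exI[of _ 0]\<close>)

lemma upper_env_mono:
  assumes "\<And>x. \<bar>h x\<bar> \<le> 1" "0 \<le> e" "\<bar>x - w\<bar> + e \<le> r"
  shows "upper_env e h x \<le> upper_env r h w"
  using assms(2) by (rule upper_env_least) (rule upper_env_ge[OF assms(1)], use assms(3) in linarith)

lemma lower_env_mono:
  assumes "\<And>x. \<bar>h x\<bar> \<le> 1" "0 \<le> e" "\<bar>x - w\<bar> + e \<le> r"
  shows "lower_env r h w \<le> lower_env e h x"
  using assms(2) by (rule lower_env_greatest) (rule lower_env_le[OF assms(1)], use assms(3) in linarith)

text \<open>
  Integrals of non-integrable functions have value zero, so monotonicity and linearity are stated for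
  bounded measurable functions, where they hold.
\<close>
lemma normal_mean_mono:
  assumes "f \<in> borel_measurable borel" "g \<in> borel_measurable borel"
    "\<And>x. \<bar>f x\<bar> \<le> B" "\<And>x. \<bar>g x\<bar> \<le> B" "\<And>x. f x \<le> g x"
  shows "normal_mean f \<le> normal_mean g"
  unfolding normal_mean_def by (intro integral_mono integrable_bounded_normal[where B = B] assms)

lemma normal_mean_diff:
  assumes "f \<in> borel_measurable borel" "g \<in> borel_measurable borel"
    "\<And>x. \<bar>f x\<bar> \<le> B" "\<And>x. \<bar>g x\<bar> \<le> B"
  shows "normal_mean (\<lambda>x. f x - g x) = normal_mean f - normal_mean g"
  unfolding normal_mean_def by (intro Bochner_Integration.integral_diff integrable_bounded_normal[where B = B] assms)

section \<open>From the Stein estimate to the discrepancy over a class\<close>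

text \<open>
  The interface between the combinatorial and the analytic part: a finite uniform sample with unit
  second moment that satisfies the Stein estimate at range \<open>A\<close>.
\<close>
locale stein_sample =
  fixes P :: "'p set" and Y :: "'p \<Rightarrow> real" and A :: real
  assumes finite: "finite P" and nonempty: "P \<noteq> {}" and A_pos: "0 < A"
    and second_moment: "(\<Sum>p\<in>P. (Y p)\<^sup>2) = card P"
    and stein_bound: "\<And>f f' K. (\<And>x. (f has_real_derivative f' x) (at x)) \<Longrightarrow>
      (\<And>x y. \<bar>x - y\<bar> \<le> A \<Longrightarrow> \<bar>f' x - f' y\<bar> \<le> K x) \<Longrightarrow>
      \<bar>\<Sum>p\<in>P. f' (Y p) - Y p * f (Y p)\<bar> \<le> (\<Sum>p\<in>P. K (Y p))"
begin

definition mean :: "(real \<Rightarrow> real) \<Rightarrow> real" where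
  "mean h = (\<Sum>p\<in>P. h (Y p)) / card P"

lemma card_pos: "0 < real (card P)"
  using finite nonempty by (simp add: card_gt_0_iff)

lemma mean_const [simp]: "mean (\<lambda>_. c) = c"
  using card_pos by (simp add: mean_def)

lemma mean_add: "mean (\<lambda>x. f x + g x) = mean f + mean g"
  by (simp add: mean_def sum.distrib add_divide_distrib)

lemma mean_diff: "mean (\<lambda>x. f x - g x) = mean f - mean g"
  by (simp add: mean_def sum_subtractf diff_divide_distrib)

lemma mean_mult: "mean (\<lambda>x. c * f x) = c * mean f"
  by (simp add: mean_def sum_distrib_left)

lemma mean_mono: "(\<And>x. f x \<le> g x) \<Longrightarrow> mean f \<le> mean g"
  unfolding mean_def by (intro divide_right_mono sum_mono) auto

lemma mean_abs_le_1: "mean (\<lambda>x. \<bar>x\<bar>) \<le> 1"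
proof -
  have "mean (\<lambda>x. \<bar>x\<bar>) \<le> mean (\<lambda>x. 1/2 + 1/2 * x\<^sup>2)"
  proof (rule mean_mono)
    fix x :: real
    have "0 \<le> (\<bar>x\<bar> - 1)\<^sup>2" by simp
    thus "\<bar>x\<bar> \<le> 1/2 + 1/2 * x\<^sup>2" by (simp add: power2_diff)
  qed
  also have "\<dots> = 1"
    using card_pos second_moment by (simp only: mean_add mean_mult mean_const) (simp add: mean_def)
  finally show ?thesis .
qed

lemma mean_stein_bound:
  assumes "\<And>x. (f has_real_derivative f' x) (at x)"
    and "\<And>x y. \<bar>x - y\<bar> \<le> A \<Longrightarrow> \<bar>f' x - f' y\<bar> \<le> K x"
  shows "\<bar>mean (\<lambda>x. f' x - x * f x)\<bar> \<le> mean K"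
  using divide_right_mono[OF stein_bound[of f f' K, OF assms], of "real (card P)"] card_pos
  by (simp add: mean_def abs_divide)

text \<open>
  The Stein estimate for the solution belonging to a window average. The modulus splits into the
  variation of \<open>x * f x\<close>, which the bounds on \<open>f\<close> control, and that of the window average, where half
  width \<open>2 * A\<close> turns a shift by \<open>A\<close> into a quarter of the oscillation. The range \<open>3 * A\<close> is
  that shift plus the half width.
\<close>
lemma window_average_discrepancy:
  assumes meas: "k \<in> borel_measurable borel" and b: "\<And>x. \<bar>k x\<bar> \<le> 1"
    and lu: "\<And>u x. \<bar>u - x\<bar> \<le> 3 * A \<Longrightarrow> L x \<le> k u \<and> k u \<le> U x"
  shows "\<bar>mean (window_average (2 * A) k) - normal_mean (window_average (2 * A) k)\<bar>
     \<le> 14 * A + mean (\<lambda>x. U x - L x) / 4"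
proof -
  define g where "g = window_average (2 * A) k"
  have e: "0 < 2 * A" using A_pos by simp
  have gb: "\<bar>g x\<bar> \<le> 1" for x
    using window_average_bounds[OF e meas b, of x "-1" 1] b
    by (auto simp: g_def abs_le_iff minus_le_iff)
  have cont: "continuous_on UNIV g" unfolding g_def by (rule continuous_window_average[OF e meas b])
  obtain f where f: "\<And>x. (f has_real_derivative x * f x + g x - normal_mean g) (at x)"
    and f10: "\<And>x. \<bar>f x\<bar> \<le> 10" and xf: "\<And>x. \<bar>x * f x\<bar> \<le> 2"
    using stein_solution[OF cont gb] by blast
  have gN: "\<bar>normal_mean g\<bar> \<le> 1"
    by (rule abs_normal_mean_le[OF borel_measurable_continuous_onI[OF cont] gb])
  define f' where "f' x = x * f x + g x - normal_mean g" for x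
  have f4: "\<bar>f' x\<bar> \<le> 4" for x
    using xf[of x] gb[of x] gN unfolding f'_def by linarith
  define K where "K x = A * (4 * \<bar>x\<bar> + 10) + (U x - L x) / 4" for x
  have "\<bar>mean (\<lambda>x. f' x - x * f x)\<bar> \<le> mean K"
  proof (rule mean_stein_bound)
    show "(f has_real_derivative f' x) (at x)" for x unfolding f'_def by (rule f)
    fix x y :: real assume xy: "\<bar>x - y\<bar> \<le> A"
    obtain \<xi> where "f x - f y = (x - y) * f' \<xi>"
      using mvt_closed_segment[of f f' x y] f unfolding f'_def by blast
    hence "\<bar>f x - f y\<bar> \<le> A * 4"
      using xy f4[of \<xi>] A_pos by (simp add: abs_mult mult_mono)
    hence "\<bar>x\<bar> * \<bar>f x - f y\<bar> \<le> \<bar>x\<bar> * (A * 4)" by (rule mult_left_mono) simp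
    moreover have "\<bar>x - y\<bar> * \<bar>f y\<bar> \<le> A * 10" using xy f10[of y] A_pos by (intro mult_mono) auto
    moreover have "x * f x - y * f y = x * (f x - f y) + (x - y) * f y" by (simp add: algebra_simps)
    ultimately have 1: "\<bar>x * f x - y * f y\<bar> \<le> A * (4 * \<bar>x\<bar> + 10)"
      using abs_triangle_ineq[of "x * (f x - f y)" "(x - y) * f y"]
      unfolding abs_mult by (simp only: distrib_left mult_ac)
    have "\<bar>g x - g y\<bar> \<le> \<bar>x - y\<bar> * (U x - L x) / (2 * (2 * A))"
      unfolding g_def by (rule window_average_modulus[OF e meas b]) (rule lu, use xy in linarith)
    also have "\<dots> \<le> A * (U x - L x) / (2 * (2 * A))"
      using xy A_pos lu[of x x] by (intro divide_right_mono mult_right_mono) auto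
    also have "\<dots> = (U x - L x) / 4" using A_pos by simp
    finally show "\<bar>f' x - f' y\<bar> \<le> K x" using 1 unfolding f'_def K_def by linarith
  qed
  also have "mean K = 4 * A * mean (\<lambda>x. \<bar>x\<bar>) + 10 * A + mean (\<lambda>x. U x - L x) / 4"
  proof -
    have "K = (\<lambda>x. (4 * A * \<bar>x\<bar> + 10 * A) + 1 / 4 * (U x - L x))"
      by (simp add: K_def fun_eq_iff algebra_simps)
    thus ?thesis by (simp only: mean_add mean_mult mean_const)
  qed
  also have "\<dots> \<le> 14 * A + mean (\<lambda>x. U x - L x) / 4"
    using mult_left_mono[OF mean_abs_le_1, of "4 * A"] A_pos by simp
  also have "mean (\<lambda>x. f' x - x * f x) = mean g - normal_mean g"
    by (simp add: f'_def mean_diff)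
  finally show ?thesis unfolding g_def .
qed

text \<open>
  The bootstrap: the oscillation at scale \<open>5 * A\<close> is a difference of two members of the class, so its
  sample mean is its normal mean up to \<open>2 * \<delta>\<close>. Since it enters with the factor \<open>1 / 4\<close>,
  the supremum \<open>\<delta>\<close> reappears with the factor \<open>1 / 2\<close> and can be absorbed.
\<close>
theorem discrepancy_bound:
  assumes ne: "H \<noteq> {}" and meas: "H \<subseteq> borel_measurable borel"
    and b: "\<And>h x. h \<in> H \<Longrightarrow> \<bar>h x\<bar> \<le> 1"
    and env: "\<And>e h. 0 < e \<Longrightarrow> h \<in> H \<Longrightarrow> upper_env e h \<in> H \<and> lower_env e h \<in> H"
    and sm: "smoothing_constant H \<alpha>"
  shows "(SUP h\<in>H. \<bar>mean h - normal_mean h\<bar>) \<le> A * (28 + 21 / 2 * \<alpha>)"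
proof -
  let ?d = "\<lambda>h. \<bar>mean h - normal_mean h\<bar>"
  define \<delta> where "\<delta> = (SUP h\<in>H. ?d h)"
  have m: "h \<in> borel_measurable borel" if "h \<in> H" for h using that meas by auto
  have meanb: "\<bar>mean h\<bar> \<le> 1" if "h \<in> H" for h
    using mean_mono[of h "\<lambda>_. 1"] mean_mono[of "\<lambda>_. -1" h] b[OF that]
    by (auto simp: abs_le_iff minus_le_iff)
  have bdd: "bdd_above (?d ` H)"
  proof (rule bdd_aboveI)
    fix y assume "y \<in> ?d ` H"
    then obtain h where h: "h \<in> H" "y = ?d h" by auto
    thus "y \<le> 2" using meanb[of h] abs_normal_mean_le[OF m[OF h(1)] b[OF h(1)]] by linarith
  qed
  have d: "?d h \<le> \<delta>" if "h \<in> H" for h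
    unfolding \<delta>_def by (rule cSUP_upper[OF that bdd])
  have osc: "normal_mean (upper_env e h) - normal_mean (lower_env e h) \<le> \<alpha> * e"
    if "0 < e" "h \<in> H" for e h
  proof -
    have "upper_env e h \<in> H" "lower_env e h \<in> H" using env that by auto
    hence "normal_mean (\<lambda>x. upper_env e h x - lower_env e h x)
      = normal_mean (upper_env e h) - normal_mean (lower_env e h)"
      by (intro normal_mean_diff[where B = 1] m b)
    moreover have "normal_mean (\<lambda>x. upper_env e h x - lower_env e h x) \<le> \<alpha> * e"
      using sm that unfolding smoothing_constant_def by blast
    ultimately show ?thesis by simp
  qed
  have osc_mean: "mean (\<lambda>x. upper_env e h x - lower_env e h x) \<le> \<alpha> * e + 2 * \<delta>"
    if "0 < e" "h \<in> H" for e h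
    using osc[OF that] d[of "upper_env e h"] d[of "lower_env e h"] env[OF that]
    unfolding mean_diff by linarith
  have single: "?d h \<le> A * (14 + 21 / 4 * \<alpha>) + \<delta> / 2" if h: "h \<in> H" for h
  proof -
    have A2: "0 < 2 * A" and A4: "0 < 4 * A" and A5: "0 < 5 * A" using A_pos by auto
    have hb: "\<bar>h x\<bar> \<le> 1" for x by (rule b[OF h])
    \<comment> \<open>An envelope at scale \<open>2 * A\<close> evaluated within \<open>3 * A\<close> of \<open>x\<close> sees only values of \<open>h\<close> within
      \<open>5 * A\<close> of \<open>x\<close>; inside the window itself, within \<open>4 * A\<close>.\<close>
    have between: "lower_env (5 * A) h x \<le> k u \<and> k u \<le> upper_env (5 * A) h x"
      and between4: "\<bar>u - x\<bar> \<le> 2 * A \<Longrightarrow> lower_env (4 * A) h x \<le> k u \<and> k u \<le> upper_env (4 * A) h x"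
      if "\<bar>u - x\<bar> \<le> 3 * A" "k = upper_env (2 * A) h \<or> k = lower_env (2 * A) h" for u x k
    proof -
      have lu: "lower_env (2 * A) h u \<le> h u" "h u \<le> upper_env (2 * A) h u"
        using A_pos by (auto intro!: lower_env_le upper_env_ge hb)
      have "lower_env r h x \<le> lower_env (2 * A) h u \<and> upper_env (2 * A) h u \<le> upper_env r h x"
        if "\<bar>u - x\<bar> + 2 * A \<le> r" for r
        using that A_pos by (auto intro!: lower_env_mono upper_env_mono hb)
      from this[of "5 * A"] this[of "4 * A"] lu that
      show "lower_env (5 * A) h x \<le> k u \<and> k u \<le> upper_env (5 * A) h x"
        and "\<bar>u - x\<bar> \<le> 2 * A \<Longrightarrow> lower_env (4 * A) h x \<le> k u \<and> k u \<le> upper_env (4 * A) h x"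
        by auto
    qed
    have smooth: "\<bar>mean (window_average (2 * A) k) - normal_mean (window_average (2 * A) k)\<bar>
           \<le> A * (14 + 5 / 4 * \<alpha>) + \<delta> / 2"
      and close: "normal_mean (lower_env (4 * A) h) \<le> normal_mean (window_average (2 * A) k)"
        "normal_mean (window_average (2 * A) k) \<le> normal_mean (upper_env (4 * A) h)"
      and sides: "\<And>x. \<bar>window_average (2 * A) k x\<bar> \<le> 1" "window_average (2 * A) k \<in> borel_measurable borel"
      if k: "k = upper_env (2 * A) h \<or> k = lower_env (2 * A) h" for k
    proof -
      have kH: "k \<in> H" using k env[OF A2 h] by auto
      note kb = m[OF kH] b[OF kH]
      have "\<bar>mean (window_average (2 * A) k) - normal_mean (window_average (2 * A) k)\<bar>
         \<le> 14 * A + mean (\<lambda>x. upper_env (5 * A) h x - lower_env (5 * A) h x) / 4"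
        by (rule window_average_discrepancy[OF kb]) (rule between[OF _ k])
      also have "\<dots> \<le> 14 * A + (\<alpha> * (5 * A) + 2 * \<delta>) / 4"
        using osc_mean[OF A5 h] by simp
      finally show "\<bar>mean (window_average (2 * A) k) - normal_mean (window_average (2 * A) k)\<bar>
           \<le> A * (14 + 5 / 4 * \<alpha>) + \<delta> / 2" by (simp add: field_simps)
      show wm: "window_average (2 * A) k \<in> borel_measurable borel"
        by (rule borel_measurable_continuous_onI[OF continuous_window_average[OF A2 kb]])
      show wb: "\<bar>window_average (2 * A) k x\<bar> \<le> 1" for x
        using window_average_bounds[OF A2 kb, of x "-1" 1] kb(2)
        by (auto simp: abs_le_iff minus_le_iff)
      have win: "lower_env (4 * A) h x \<le> window_average (2 * A) k x"
        "window_average (2 * A) k x \<le> upper_env (4 * A) h x" for x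
        using window_average_bounds[OF A2 kb, of x "lower_env (4 * A) h x" "upper_env (4 * A) h x"]
          between4[OF _ k] A_pos by auto
      have uH: "upper_env (4 * A) h \<in> H" and lH: "lower_env (4 * A) h \<in> H"
        using env[OF A4 h] by auto
      show "normal_mean (lower_env (4 * A) h) \<le> normal_mean (window_average (2 * A) k)"
        "normal_mean (window_average (2 * A) k) \<le> normal_mean (upper_env (4 * A) h)"
        by (intro normal_mean_mono[OF m[OF lH] wm b[OF lH] wb win(1)]
              normal_mean_mono[OF wm m[OF uH] wb b[OF uH] win(2)])+
    qed
    have ul: "normal_mean (upper_env (4 * A) h) - normal_mean (lower_env (4 * A) h) \<le> \<alpha> * (4 * A)"
      by (rule osc[OF A4 h])
    have hN: "normal_mean (lower_env (4 * A) h) \<le> normal_mean h" "normal_mean h \<le> normal_mean (upper_env (4 * A) h)"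
    proof -
      have uH: "upper_env (4 * A) h \<in> H" and lH: "lower_env (4 * A) h \<in> H"
        using env[OF A4 h] by auto
      have "lower_env (4 * A) h x \<le> h x" "h x \<le> upper_env (4 * A) h x" for x
        using A_pos by (auto intro!: lower_env_le upper_env_ge hb)
      thus "normal_mean (lower_env (4 * A) h) \<le> normal_mean h" "normal_mean h \<le> normal_mean (upper_env (4 * A) h)"
        using normal_mean_mono[OF m[OF lH] m[OF h] b[OF lH] hb]
          normal_mean_mono[OF m[OF h] m[OF uH] hb b[OF uH]] by auto
    qed
    have hi: "mean h \<le> mean (window_average (2 * A) (upper_env (2 * A) h))"
    proof (rule mean_mono)
      fix x
      have "upper_env (2 * A) h \<in> H" using env[OF A2 h] by simp
      note kb = m[OF this] b[OF this]
      show "h x \<le> window_average (2 * A) (upper_env (2 * A) h) x"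
        by (rule window_average_bounds(1)[OF A2 kb, where U = 1])
           (use kb(2) in \<open>auto simp: abs_le_iff abs_minus_commute intro!: upper_env_ge hb\<close>)
    qed
    have lo: "mean (window_average (2 * A) (lower_env (2 * A) h)) \<le> mean h"
    proof (rule mean_mono)
      fix x
      have "lower_env (2 * A) h \<in> H" using env[OF A2 h] by simp
      note kb = m[OF this] b[OF this]
      show "window_average (2 * A) (lower_env (2 * A) h) x \<le> h x"
        by (rule window_average_bounds(2)[OF A2 kb, where L = "-1"])
           (use kb(2) in \<open>auto simp: abs_le_iff minus_le_iff abs_minus_commute intro!: lower_env_le hb\<close>)
    qed
    have goal: "A * (14 + 21 / 4 * \<alpha>) + \<delta> / 2 = (A * (14 + 5 / 4 * \<alpha>) + \<delta> / 2) + \<alpha> * (4 * A)"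
      by (simp add: field_simps)
    show ?thesis unfolding goal
      using smooth[of "upper_env (2 * A) h"] smooth[of "lower_env (2 * A) h"]
        close[of "upper_env (2 * A) h"] close[of "lower_env (2 * A) h"] ul hN hi lo by auto
  qed
  have "\<delta> \<le> A * (14 + 21 / 4 * \<alpha>) + \<delta> / 2"
    unfolding \<delta>_def by (rule cSUP_least[OF ne]) (use single in \<open>simp add: \<delta>_def\<close>)
  thus ?thesis unfolding \<delta>_def[symmetric] by (simp add: algebra_simps)
qed

end

section \<open>Half lines and intervals\<close>

lemma upper_env_indicator:
  assumes "0 < e"
  shows "upper_env e (indicator S) = indicator {x. \<exists>u\<in>S. \<bar>u - x\<bar> \<le> e}"
proof
  fix x
  have ge: "indicator S u \<le> upper_env e (indicator S) x" if "\<bar>u - x\<bar> \<le> e" for u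
    by (rule upper_env_ge) (use that in \<open>auto simp: indicator_def\<close>)
  show "upper_env e (indicator S) x = indicator {x. \<exists>u\<in>S. \<bar>u - x\<bar> \<le> e} x"
  proof (rule antisym)
    show "upper_env e (indicator S) x \<le> indicator {x. \<exists>u\<in>S. \<bar>u - x\<bar> \<le> e} x"
      by (rule upper_env_least) (use assms in \<open>auto simp: indicator_def\<close>)
    show "indicator {x. \<exists>u\<in>S. \<bar>u - x\<bar> \<le> e} x \<le> upper_env e (indicator S) x"
    proof (cases "\<exists>u\<in>S. \<bar>u - x\<bar> \<le> e")
      case True
      then obtain u where "u \<in> S" "\<bar>u - x\<bar> \<le> e" by blast
      thus ?thesis using ge[of u] True by simp
    next
      case False
      have "0 \<le> upper_env e (indicator S) x"
        by (rule order.trans[OF _ ge[of x]]) (use assms in auto)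
      thus ?thesis using False by simp
    qed
  qed
qed

lemma lower_env_indicator:
  assumes "0 < e"
  shows "lower_env e (indicator S) = indicator {x. \<forall>u. \<bar>u - x\<bar> \<le> e \<longrightarrow> u \<in> S}"
proof
  fix x
  have le: "lower_env e (indicator S) x \<le> indicator S u" if "\<bar>u - x\<bar> \<le> e" for u
    by (rule lower_env_le) (use that in \<open>auto simp: indicator_def\<close>)
  show "lower_env e (indicator S) x = indicator {x. \<forall>u. \<bar>u - x\<bar> \<le> e \<longrightarrow> u \<in> S} x"
  proof (rule antisym)
    show "lower_env e (indicator S) x \<le> indicator {x. \<forall>u. \<bar>u - x\<bar> \<le> e \<longrightarrow> u \<in> S} x"
    proof (cases "\<forall>u. \<bar>u - x\<bar> \<le> e \<longrightarrow> u \<in> S")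
      case True
      have "lower_env e (indicator S) x \<le> 1"
        by (rule order.trans[OF le[of x]]) (use assms in \<open>auto simp: indicator_def\<close>)
      thus ?thesis using True by simp
    next
      case False
      then obtain u where "u \<notin> S" "\<bar>u - x\<bar> \<le> e" by blast
      thus ?thesis using le[of u] False by simp
    qed
    show "indicator {x. \<forall>u. \<bar>u - x\<bar> \<le> e \<longrightarrow> u \<in> S} x \<le> lower_env e (indicator S) x"
      by (rule lower_env_greatest) (use assms in \<open>auto simp: indicator_def\<close>)
  qed
qed

lemma normal_mean_interval_le:
  assumes "0 \<le> e"
  shows "normal_mean (indicator {c - e..c + e}) \<le> sqrt (2 / pi) * e"
proof -
  have "normal_mean (indicator {c - e..c + e})
      = (\<integral>x. std_normal_density x * indicator {c - e..c + e} x \<partial>lborel)"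
    by (rule normal_mean_lebesgue) simp
  also have "\<dots> \<le> (\<integral>x. 1 / sqrt (2 * pi) * indicator {c - e..c + e} x \<partial>lborel)"
  proof (rule integral_mono')
    show "integrable lborel (\<lambda>x. 1 / sqrt (2 * pi) * indicator {c - e..c + e} x)"
      by (intro integrable_mult_right integrable_interval)
    show "std_normal_density x * indicator {c - e..c + e} x \<le> 1 / sqrt (2 * pi) * indicator {c - e..c + e} x" for x
      by (intro mult_right_mono) (auto simp: std_normal_density_def divide_right_mono)
  qed simp
  also have "\<dots> = 2 / sqrt (2 * pi) * e" using assms by simp
  also have "2 / sqrt (2 * pi) = sqrt (2 / pi)"
    by (simp add: real_sqrt_mult real_sqrt_divide field_simps)
  finally show ?thesis .
qed

text \<open>
  The oscillation of an indicator at scale \<open>e\<close> is nonzero at \<open>x\<close> only if points inside and outside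
  the set both lie within \<open>e\<close> of \<open>x\<close>. If a boundary point in \<open>B S\<close> separates any such two points, it
  is within \<open>e\<close> of \<open>x\<close> as well. So the oscillation is carried by \<open>m\<close> intervals of length \<open>2 * e\<close>,
  and the normal density is at most \<open>1 / sqrt (2 * pi)\<close>. The first assumption states the separation as
  equality in the triangle inequality, which covers both orders of \<open>s\<close> and \<open>t\<close>.
\<close>
lemma smoothing_constant_indicators:
  assumes "\<And>S s t. S \<in> \<S> \<Longrightarrow> s \<in> S \<Longrightarrow> t \<notin> S \<Longrightarrow> \<exists>c\<in>B S. \<bar>s - c\<bar> + \<bar>t - c\<bar> \<le> \<bar>s - t\<bar>"
    and "\<And>S. S \<in> \<S> \<Longrightarrow> finite (B S) \<and> card (B S) \<le> m"
  shows "smoothing_constant (indicator ` \<S>) (m * sqrt (2 / pi))"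
  unfolding smoothing_constant_def
proof (intro allI impI ballI)
  fix e :: real and h :: "real \<Rightarrow> real" assume e: "0 < e" and "h \<in> indicator ` \<S>"
  then obtain S where S: "S \<in> \<S>" and h: "h = indicator S" by auto
  have int: "integrable std_normal_distribution (indicator {c - e..c + e} :: real \<Rightarrow> real)" for c
    by (rule integrable_bounded_normal[where B = 1]) (auto simp: indicator_def)
  have "normal_mean (\<lambda>x. upper_env e h x - lower_env e h x)
     \<le> normal_mean (\<lambda>x. \<Sum>c\<in>B S. indicator {c - e..c + e} x)"
    unfolding normal_mean_def
  proof (rule integral_mono')
    show "integrable std_normal_distribution (\<lambda>x. \<Sum>c\<in>B S. indicator {c - e..c + e} x :: real)"
      by (intro Bochner_Integration.integrable_sum int)
    fix x
    show pos: "0 \<le> (\<Sum>c\<in>B S. indicator {c - e..c + e} x :: real)"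
      by (rule sum_nonneg) simp
    show "upper_env e h x - lower_env e h x \<le> (\<Sum>c\<in>B S. indicator {c - e..c + e} x)"
    proof (cases "\<exists>s\<in>S. \<exists>t. t \<notin> S \<and> \<bar>s - x\<bar> \<le> e \<and> \<bar>t - x\<bar> \<le> e")
      case True
      then obtain s t where st: "s \<in> S" "t \<notin> S" "\<bar>s - x\<bar> \<le> e" "\<bar>t - x\<bar> \<le> e" by auto
      then obtain c where c: "c \<in> B S" "\<bar>s - c\<bar> + \<bar>t - c\<bar> \<le> \<bar>s - t\<bar>" using assms(1)[OF S] by blast
      have "x \<in> {c - e..c + e}" using c(2) st(3,4) by (auto simp: abs_le_iff abs_if split: if_splits)
      hence "1 = (indicator {c - e..c + e} x :: real)" by simp
      also have "\<dots> \<le> (\<Sum>c\<in>B S. indicator {c - e..c + e} x)"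
        by (rule member_le_sum) (use c assms(2)[OF S] in auto)
      finally show ?thesis unfolding h upper_env_indicator[OF e] lower_env_indicator[OF e]
        by (auto simp: indicator_def split: if_splits)
    next
      case False
      hence "upper_env e h x - lower_env e h x \<le> 0"
        unfolding h upper_env_indicator[OF e] lower_env_indicator[OF e]
        by (auto simp: indicator_def)
      thus ?thesis using pos by linarith
    qed
  qed
  also have "\<dots> = (\<Sum>c\<in>B S. normal_mean (indicator {c - e..c + e}))"
    unfolding normal_mean_def by (rule Bochner_Integration.integral_sum[OF int])
  also have "\<dots> \<le> (\<Sum>c\<in>B S. sqrt (2 / pi) * e)"
    by (intro sum_mono normal_mean_interval_le) (use e in simp)
  also have "\<dots> \<le> m * (sqrt (2 / pi) * e)"
    using assms(2)[OF S] e by (simp add: mult_right_mono)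
  finally show "normal_mean (\<lambda>x. upper_env e h x - lower_env e h x) \<le> m * sqrt (2 / pi) * e"
    by (simp add: mult.assoc)
qed

lemma interval_indicators_image: "interval_indicators = indicator ` {S. is_interval S}"
  by (auto simp: interval_indicators_def)

definition half_line_at :: "real \<Rightarrow> real set \<Rightarrow> bool" where
  "half_line_at z S \<longleftrightarrow> S = {..z} \<or> S = {..<z} \<or> S = {z..} \<or> S = {z<..}"

lemma half_line_indicators_image: "half_line_indicators = indicator ` {S. \<exists>z. half_line_at z S}"
  by (auto simp: half_line_indicators_def half_line_at_def image_iff) 

lemma smoothing_constant_half_lines: "smoothing_constant half_line_indicators (sqrt (2 / pi))"
proof -
  define z where "z S = (SOME z. half_line_at z S)" for S
  have z: "half_line_at (z S) S" if "S \<in> {S. \<exists>z. half_line_at z S}" for S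
    unfolding z_def using that by (auto intro: someI_ex)
  have "smoothing_constant (indicator ` {S. \<exists>z. half_line_at z S}) (1 * sqrt (2 / pi))"
  proof (rule smoothing_constant_indicators[where B = "\<lambda>S. {z S}" and m = 1, simplified of_nat_1])
    fix S s t assume "S \<in> {S. \<exists>z. half_line_at z S}" "s \<in> S" "t \<notin> S"
    hence "half_line_at (z S) S" "s \<in> S" "t \<notin> S" using z by blast+
    moreover have "\<bar>s - w\<bar> + \<bar>t - w\<bar> \<le> \<bar>s - t\<bar>" if "half_line_at w S" "s \<in> S" "t \<notin> S" for w
      using that unfolding half_line_at_def by auto
    ultimately show "\<exists>c\<in>{z S}. \<bar>s - c\<bar> + \<bar>t - c\<bar> \<le> \<bar>s - t\<bar>" by blast
  qed simp
  thus ?thesis by (simp add: half_line_indicators_image)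
qed

text \<open>
  Infimum and supremum serve as boundary points. For an unbounded or empty set one of them may be an
  arbitrary real, which does no harm: the infimum is used only when some point outside the set lies
  below a point of it, and such a point is a lower bound by convexity; likewise for the supremum.
\<close>
lemma smoothing_constant_intervals: "smoothing_constant interval_indicators (2 * sqrt (2 / pi))"
proof -
  have "smoothing_constant (indicator ` {S. is_interval S}) (real 2 * sqrt (2 / pi))"
  proof (rule smoothing_constant_indicators[where B = "\<lambda>S. {Inf S, Sup S}"])
    fix S :: "real set" and s t assume S: "S \<in> {S. is_interval S}" "s \<in> S" "t \<notin> S"
    have conv: "x \<in> S" if "a \<in> S" "b \<in> S" "a \<le> x" "x \<le> b" for a b x
      using S that unfolding is_interval_1 by blast
    show "\<exists>c\<in>{Inf S, Sup S}. \<bar>s - c\<bar> + \<bar>t - c\<bar> \<le> \<bar>s - t\<bar>"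
    proof (cases "t < s")
      case True
      have lb: "t \<le> x" if "x \<in> S" for x
        using conv[OF that \<open>s \<in> S\<close>, of t] True \<open>t \<notin> S\<close> by force
      have "t \<le> Inf S" using S lb by (intro cInf_greatest) auto
      moreover have "Inf S \<le> s" using S lb by (intro cInf_lower bdd_belowI) auto
      ultimately show ?thesis by auto
    next
      case False
      hence "s < t" using S by (cases "s = t") auto
      have ub: "x \<le> t" if "x \<in> S" for x
        using conv[OF \<open>s \<in> S\<close> that, of t] \<open>s < t\<close> \<open>t \<notin> S\<close> by force
      have "Sup S \<le> t" using S ub by (intro cSup_least) auto
      moreover have "s \<le> Sup S" using S ub by (intro cSup_upper bdd_aboveI) auto
      ultimately show ?thesis by auto
    qed
  qed (auto simp: card_insert_if)
  thus ?thesis by (simp add: interval_indicators_image)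
qed

text \<open>
  An envelope only moves the end point by \<open>e\<close>: for a half line, whether some or all of the points
  within \<open>e\<close> of \<open>x\<close> belong to it is decided by \<open>x - e\<close> or \<open>x + e\<close> alone.
\<close>
lemma half_line_env_closed:
  assumes "0 < e" "h \<in> half_line_indicators"
  shows "upper_env e h \<in> half_line_indicators \<and> lower_env e h \<in> half_line_indicators"
proof -
  obtain S z where h: "h = indicator S" and S: "half_line_at z S"
    using assms(2) by (auto simp: half_line_indicators_image)
  let ?T = "{x. \<exists>u\<in>S. \<bar>u - x\<bar> \<le> e}" and ?L = "{x. \<forall>u. \<bar>u - x\<bar> \<le> e \<longrightarrow> u \<in> S}"
  have dn: "x \<in> ?T \<longleftrightarrow> x - e \<in> S" "x \<in> ?L \<longleftrightarrow> x + e \<in> S"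
    if mono: "\<And>u v. v \<in> S \<Longrightarrow> u \<le> v \<Longrightarrow> u \<in> S" for x
  proof -
    have "x - e \<in> S" if "u \<in> S" "\<bar>u - x\<bar> \<le> e" for u
      by (rule mono[OF that(1)]) (use that in auto)
    moreover have "\<bar>(x - e) - x\<bar> \<le> e" using assms(1) by simp
    ultimately show "x \<in> ?T \<longleftrightarrow> x - e \<in> S" by blast
    have "u \<in> S" if "x + e \<in> S" "\<bar>u - x\<bar> \<le> e" for u
      by (rule mono[OF that(1)]) (use that in auto)
    moreover have "\<bar>(x + e) - x\<bar> \<le> e" using assms(1) by simp
    ultimately show "x \<in> ?L \<longleftrightarrow> x + e \<in> S" by blast
  qed
  have up: "x \<in> ?T \<longleftrightarrow> x + e \<in> S" "x \<in> ?L \<longleftrightarrow> x - e \<in> S"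
    if mono: "\<And>u v. v \<in> S \<Longrightarrow> v \<le> u \<Longrightarrow> u \<in> S" for x
  proof -
    have "x + e \<in> S" if "u \<in> S" "\<bar>u - x\<bar> \<le> e" for u
      by (rule mono[OF that(1)]) (use that in auto)
    moreover have "\<bar>(x + e) - x\<bar> \<le> e" using assms(1) by simp
    ultimately show "x \<in> ?T \<longleftrightarrow> x + e \<in> S" by blast
    have "u \<in> S" if "x - e \<in> S" "\<bar>u - x\<bar> \<le> e" for u
      by (rule mono[OF that(1)]) (use that in auto)
    moreover have "\<bar>(x - e) - x\<bar> \<le> e" using assms(1) by simp
    ultimately show "x \<in> ?L \<longleftrightarrow> x - e \<in> S" by blast
  qed
  consider "S = {..z}" | "S = {..<z}" | "S = {z..}" | "S = {z<..}"
    using S by (auto simp: half_line_at_def)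
  hence "(\<exists>w. half_line_at w ?T) \<and> (\<exists>w. half_line_at w ?L)"
  proof cases
    case 1
    have mono: "\<And>u v. v \<in> S \<Longrightarrow> u \<le> v \<Longrightarrow> u \<in> S" using 1 by auto
    have "?T = {..z + e}"
      by (rule set_eqI, rule trans[OF dn(1)[OF mono]]) (use 1 in auto)
    moreover have "?L = {..z - e}"
      by (rule set_eqI, rule trans[OF dn(2)[OF mono]]) (use 1 in auto)
    ultimately show ?thesis unfolding half_line_at_def by blast
  next
    case 2
    have mono: "\<And>u v. v \<in> S \<Longrightarrow> u \<le> v \<Longrightarrow> u \<in> S" using 2 by auto
    have "?T = {..<z + e}"
      by (rule set_eqI, rule trans[OF dn(1)[OF mono]]) (use 2 in auto)
    moreover have "?L = {..<z - e}"
      by (rule set_eqI, rule trans[OF dn(2)[OF mono]]) (use 2 in auto)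
    ultimately show ?thesis unfolding half_line_at_def by blast
  next
    case 3
    have mono: "\<And>u v. v \<in> S \<Longrightarrow> v \<le> u \<Longrightarrow> u \<in> S" using 3 by auto
    have "?T = {z - e..}"
      by (rule set_eqI, rule trans[OF up(1)[OF mono]]) (use 3 in auto)
    moreover have "?L = {z + e..}"
      by (rule set_eqI, rule trans[OF up(2)[OF mono]]) (use 3 in auto)
    ultimately show ?thesis unfolding half_line_at_def by blast
  next
    case 4
    have mono: "\<And>u v. v \<in> S \<Longrightarrow> v \<le> u \<Longrightarrow> u \<in> S" using 4 by auto
    have "?T = {z - e<..}"
      by (rule set_eqI, rule trans[OF up(1)[OF mono]]) (use 4 in auto)
    moreover have "?L = {z + e<..}"
      by (rule set_eqI, rule trans[OF up(2)[OF mono]]) (use 4 in auto)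
    ultimately show ?thesis unfolding half_line_at_def by blast
  qed
  thus ?thesis unfolding h upper_env_indicator[OF assms(1)] lower_env_indicator[OF assms(1)]
    by (auto simp: half_line_indicators_image)
qed

lemma interval_env_closed:
  assumes "0 < e" "h \<in> interval_indicators"
  shows "upper_env e h \<in> interval_indicators \<and> lower_env e h \<in> interval_indicators"
proof -
  obtain S where h: "h = indicator S" and S: "is_interval S"
    using assms(2) by (auto simp: interval_indicators_image)
  have conv: "x \<in> S" if "a \<in> S" "b \<in> S" "a \<le> x" "x \<le> b" for a b x
    using S that unfolding is_interval_1 by blast
  have "is_interval {x. \<exists>u\<in>S. \<bar>u - x\<bar> \<le> e}"
    unfolding is_interval_1
  proof (intro ballI allI impI, elim conjE)
    fix a b x assume "a \<in> {x. \<exists>u\<in>S. \<bar>u - x\<bar> \<le> e}" "b \<in> {x. \<exists>u\<in>S. \<bar>u - x\<bar> \<le> e}" "a \<le> x" "x \<le> b"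
    then obtain u v where uv: "u \<in> S" "v \<in> S" "\<bar>u - a\<bar> \<le> e" "\<bar>v - b\<bar> \<le> e" by blast
    show "x \<in> {x. \<exists>u\<in>S. \<bar>u - x\<bar> \<le> e}"
    proof (cases "\<bar>u - x\<bar> \<le> e \<or> \<bar>v - x\<bar> \<le> e")
      case True
      thus ?thesis using uv(1,2) by blast
    next
      case False
      have "u \<le> x" using False uv(3) \<open>a \<le> x\<close> by linarith
      moreover have "x \<le> v" using False uv(4) \<open>x \<le> b\<close> by linarith
      ultimately have "x \<in> S" by (rule conv[OF uv(1,2)])
      moreover have "\<bar>x - x\<bar> \<le> e" using assms(1) by simp
      ultimately show ?thesis by blast
    qed
  qed
  moreover have "is_interval {x. \<forall>u. \<bar>u - x\<bar> \<le> e \<longrightarrow> u \<in> S}"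
    unfolding is_interval_1
  proof (intro ballI allI impI CollectI, elim conjE)
    fix a b x u assume "a \<in> {x. \<forall>u. \<bar>u - x\<bar> \<le> e \<longrightarrow> u \<in> S}" "b \<in> {x. \<forall>u. \<bar>u - x\<bar> \<le> e \<longrightarrow> u \<in> S}"
      and x: "a \<le> x" "x \<le> b" and u: "\<bar>u - x\<bar> \<le> e"
    hence "a + (u - x) \<in> S" "b + (u - x) \<in> S" by auto
    thus "u \<in> S" by (rule conv) (use x in auto)
  qed
  ultimately show ?thesis unfolding h upper_env_indicator[OF assms(1)] lower_env_indicator[OF assms(1)]
    by (auto simp: interval_indicators_image)
qed

section \<open>Normal approximation for the permutation statistic\<close>

lemma perm_stat_stein_sample:
  assumes "finite S" "card S \<ge> 2" "\<And>i. i \<in> S \<Longrightarrow> (\<Sum>j\<in>S. a i j) = 0"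
    "\<And>i j. i \<in> S \<Longrightarrow> j \<in> S \<Longrightarrow> \<bar>a i j\<bar> \<le> C" "0 < C"
    "(\<Sum>p | p permutes S. (perm_stat S a p)\<^sup>2) = card {p. p permutes S}"
  shows "stein_sample {p. p permutes S} (perm_stat S a) (8 * C)"
proof
  show "{p. p permutes S} \<noteq> {}" using permutes_id by blast
  show "finite {p. p permutes S}" by (rule finite_permutations[OF assms(1)])
  fix f f' K :: "real \<Rightarrow> real"
  assume "\<And>x. (f has_real_derivative f' x) (at x)"
    "\<And>x y. \<bar>x - y\<bar> \<le> 8 * C \<Longrightarrow> \<bar>f' x - f' y\<bar> \<le> K x"
  with assms(1-4,6) show "\<bar>\<Sum>p | p permutes S. f' (perm_stat S a p) - perm_stat S a p * f (perm_stat S a p)\<bar>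
      \<le> (\<Sum>p | p permutes S. K (perm_stat S a p))"
    by (rule permutation_stein_bound)
qed (use assms in auto)

lemma expectation_uniform_random_permutation:
  fixes F :: "(nat \<Rightarrow> nat) \<Rightarrow> real"
  assumes "uniform_random_permutation M n \<pi>"
  shows "(\<integral>\<omega>. F (\<pi> \<omega>) \<partial>M) = (\<Sum>p | p permutes {1..n}. F p) / card {p. p permutes {1..n}}"
proof -
  let ?P = "{p. p permutes {1..n}}"
  have meas: "\<pi> \<in> measurable M (count_space ?P)"
    and distr: "distr M (count_space ?P) \<pi> = uniform_count_measure ?P"
    using assms by (auto simp: uniform_random_permutation_def)
  have "(\<integral>\<omega>. F (\<pi> \<omega>) \<partial>M) = (\<integral>p. F p \<partial>distr M (count_space ?P) \<pi>)"
    by (rule integral_distr[OF meas, symmetric]) simp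
  also have "\<dots> = (\<Sum>p\<in>?P. F p) / card ?P"
    unfolding distr by (rule integral_uniform_count_measure) (simp add: finite_permutations)
  finally show ?thesis .
qed

theorem theorem2p5:
  fixes n :: nat and a :: "nat \<Rightarrow> nat \<Rightarrow> real"
    and M :: "'w measure" and \<pi> :: "'w \<Rightarrow> nat \<Rightarrow> nat"
    and Y W :: "'w \<Rightarrow> real" and C \<sigma> A :: real
  assumes "n \<ge> 3"
    and "\<forall>i\<in>{1..n}. (\<Sum>j=1..n. a i j) = 0"
    and "C = Max {\<bar>a i j\<bar> | i j. i \<in> {1..n} \<and> j \<in> {1..n}}"
    and "prob_space M"
    and "uniform_random_permutation M n \<pi>"
    and "Y = (\<lambda>\<omega>. \<Sum>i=1..n. a i (\<pi> \<omega> i))"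
    and "\<sigma>\<^sup>2 = prob_space.variance M Y" and "\<sigma> > 0"
    and "W = (\<lambda>\<omega>. Y \<omega> / \<sigma>)"
    and "A = 8 * C / \<sigma>" and "A \<le> 1 / 12"
  shows "(\<forall>H \<alpha>. smoothing_class H \<alpha> \<longrightarrow>
            normal_discrepancy M W H \<le> A * (37 + 12 * A + 112 * \<alpha>)) \<and>
         (smoothing_constant half_line_indicators (sqrt (2 / pi)) \<and>
            normal_discrepancy M W half_line_indicators \<le> A * (127 + 12 * A)) \<and>
         (smoothing_constant interval_indicators (2 * sqrt (2 / pi)) \<and>
            normal_discrepancy M W interval_indicators \<le> A * (216 + 12 * A))"
proof -
  let ?S = "{1..n}"
  let ?P = "{p. p permutes ?S}"
  note expectation = expectation_uniform_random_permutation[OF assms(5)]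
  have cP: "0 < real (card ?P)" by (simp add: card_permutations)
  have rows: "(\<Sum>j\<in>?S. a i j) = 0" if "i \<in> ?S" for i using assms(2) that by blast
  have Y: "Y = (\<lambda>\<omega>. perm_stat ?S a (\<pi> \<omega>))"
    unfolding assms(6) perm_stat_def ..
  have EY: "(\<integral>\<omega>. Y \<omega> \<partial>M) = 0"
    unfolding Y expectation using sum_perm_stat[of ?S a] rows assms(1) by simp
  have "\<sigma>\<^sup>2 = (\<integral>\<omega>. (perm_stat ?S a (\<pi> \<omega>))\<^sup>2 \<partial>M)"
    using assms(7) unfolding EY by (simp only: Y diff_zero)
  hence var: "\<sigma>\<^sup>2 = (\<Sum>p\<in>?P. (perm_stat ?S a p)\<^sup>2) / card ?P"
    by (simp only: expectation[of "\<lambda>p. (perm_stat ?S a p)\<^sup>2"])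
  have aC: "\<bar>a i j\<bar> \<le> C" if "i \<in> ?S" "j \<in> ?S" for i j
  proof -
    have "finite {\<bar>a i j\<bar> | i j. i \<in> ?S \<and> j \<in> ?S}"
      by (rule finite_image_set2) simp_all
    thus ?thesis unfolding assms(3) by (rule Max_ge) (use that in blast)
  qed
  \<comment> \<open>The range of the Stein estimate must be positive; a zero array would have zero variance.\<close>
  have C: "0 < C"
  proof (rule ccontr)
    assume "\<not> 0 < C"
    hence zero: "a i j = 0" if "i \<in> ?S" "j \<in> ?S" for i j using aC[OF that] by linarith
    have "perm_stat ?S a p = 0" if "p permutes ?S" for p
      unfolding perm_stat_def
      by (intro sum.neutral ballI zero) (simp_all only: permutes_in_image[OF that])
    hence "\<sigma>\<^sup>2 = 0" unfolding var by simp
    thus False using assms(8) by simp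
  qed
  \<comment> \<open>Normalising the array, and not the statistic, reduces everything to unit variance.\<close>
  define b where "b i j = a i j / \<sigma>" for i j
  have b: "perm_stat ?S b p = perm_stat ?S a p / \<sigma>" for p
    by (simp add: perm_stat_def b_def sum_divide_distrib)
  interpret stein_sample ?P "perm_stat ?S b" A
  proof -
    have "stein_sample ?P (perm_stat ?S b) (8 * (C / \<sigma>))"
    proof (rule perm_stat_stein_sample)
      show "(\<Sum>j\<in>?S. b i j) = 0" if "i \<in> ?S" for i
        using rows[OF that] by (simp add: b_def sum_divide_distrib[symmetric])
      show "\<bar>b i j\<bar> \<le> C / \<sigma>" if "i \<in> ?S" "j \<in> ?S" for i j
        using aC[OF that] assms(8) by (simp add: b_def divide_right_mono)
      have "(\<Sum>p\<in>?P. (perm_stat ?S b p)\<^sup>2) = (\<Sum>p\<in>?P. (perm_stat ?S a p)\<^sup>2) / \<sigma>\<^sup>2"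
        by (simp only: b power_divide sum_divide_distrib)
      also have "(\<Sum>p\<in>?P. (perm_stat ?S a p)\<^sup>2) = \<sigma>\<^sup>2 * card ?P"
        using var cP by (simp add: field_simps)
      finally show "(\<Sum>p\<in>?P. (perm_stat ?S b p)\<^sup>2) = card ?P" using assms(8) by simp
    qed (use assms(1,8) C in auto)
    thus "stein_sample ?P (perm_stat ?S b) A" by (simp add: assms(10))
  qed
  have W: "W = (\<lambda>\<omega>. perm_stat ?S b (\<pi> \<omega>))"
    unfolding assms(9) Y b ..
  have disc: "normal_discrepancy M W H = (SUP h\<in>H. \<bar>mean h - normal_mean h\<bar>)" for H
    using expectation[of "\<lambda>p. h (perm_stat ?S b p)" for h]
    by (simp only: normal_discrepancy_def W mean_def)
  have enlarge: "A * (28 + 21 / 2 * \<alpha>) \<le> A * (c + 12 * A)" if "28 + 21 / 2 * \<alpha> \<le> c" for \<alpha> c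
    using that A_pos by (intro mult_left_mono) auto
  have pi_bound: "sqrt (2 / pi) \<le> 1" using pi_gt3 by (simp add: real_le_lsqrt)
  have "normal_discrepancy M W H \<le> A * (37 + 12 * A + 112 * \<alpha>)" if H: "smoothing_class H \<alpha>" for H \<alpha>
  proof -
    obtain h where h: "h \<in> H" using H by (auto simp: smoothing_class_def)
    have "normal_discrepancy M W H \<le> A * (28 + 21 / 2 * \<alpha>)"
      unfolding disc by (rule discrepancy_bound) (use H in \<open>auto simp: smoothing_class_def\<close>)
    also have "\<dots> \<le> A * ((37 + 112 * \<alpha>) + 12 * A)"
    proof (rule enlarge)
      \<comment> \<open>The constant \<open>\<alpha>\<close> is nonnegative because it bounds the mean of a nonnegative oscillation.\<close>
      have "0 \<le> normal_mean (\<lambda>x. upper_env 1 h x - lower_env 1 h x)"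
        unfolding normal_mean_def
      proof (rule Bochner_Integration.integral_nonneg)
        fix x
        have "\<And>x. \<bar>h x\<bar> \<le> 1" using H h by (auto simp: smoothing_class_def)
        thus "0 \<le> upper_env 1 h x - lower_env 1 h x"
          using upper_env_ge[of h x x 1] lower_env_le[of h x x 1] by auto
      qed
      also have "\<dots> \<le> \<alpha> * 1"
        using H h unfolding smoothing_class_def smoothing_constant_def by (meson zero_less_one)
      finally show "28 + 21 / 2 * \<alpha> \<le> 37 + 112 * \<alpha>" by simp
    qed
    finally show ?thesis by (simp add: algebra_simps)
  qed
  moreover have "normal_discrepancy M W half_line_indicators \<le> A * (127 + 12 * A)"
  proof -
    have "normal_discrepancy M W half_line_indicators \<le> A * (28 + 21 / 2 * sqrt (2 / pi))"
      unfolding disc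
    proof (rule discrepancy_bound)
      show "half_line_indicators \<noteq> {}" by (auto simp: half_line_indicators_def)
      show "half_line_indicators \<subseteq> borel_measurable borel"
        by (auto simp: half_line_indicators_def intro!: borel_measurable_indicator)
      show "\<bar>h x\<bar> \<le> 1" if "h \<in> half_line_indicators" for h x
        using that by (auto simp: half_line_indicators_def indicator_def)
    qed (use half_line_env_closed smoothing_constant_half_lines in auto)
    also have "\<dots> \<le> A * (127 + 12 * A)" by (rule enlarge) (use pi_bound in linarith)
    finally show ?thesis .
  qed
  moreover have "normal_discrepancy M W interval_indicators \<le> A * (216 + 12 * A)"
  proof -
    have "normal_discrepancy M W interval_indicators \<le> A * (28 + 21 / 2 * (2 * sqrt (2 / pi)))"
      unfolding disc
    proof (rule discrepancy_bound)
      show "interval_indicators \<noteq> {}" by (auto simp: interval_indicators_def)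
      show "interval_indicators \<subseteq> borel_measurable borel"
        by (auto simp: interval_indicators_def intro!: borel_measurable_indicator real_interval_borel_measurable)
      show "\<bar>h x\<bar> \<le> 1" if "h \<in> interval_indicators" for h x
        using that by (auto simp: interval_indicators_def indicator_def)
    qed (use interval_env_closed smoothing_constant_intervals in auto)
    also have "\<dots> \<le> A * (216 + 12 * A)" by (rule enlarge) (use pi_bound in linarith)
    finally show ?thesis .
  qed
  ultimately show ?thesis
    using smoothing_constant_half_lines smoothing_constant_intervals by blast
qed

end
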